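(* Let $G$ be a countable infinite residually finite group, let $(\Gamma_n)_{n\in\mathbb{N}}$ be a scale of $G$, and let $X=G_{(\Gamma_n)}$ be the associated free exact odometer. The following are equivalent: (1) $\mathrm{Aut}^\infty(X,\alpha_X,G)$ is amenable. (2) $X$ is amenable. (3) $[[L_X]]$ is amenable. (4) $[[R_X]]$ is amenable. Here amenability is that of abstract (discrete) groups.
   Context: A scale of a countable group $G$ is a decreasing sequence $(\Gamma_n)_{n\in\mathbb{N}}$ of normal finite-index subgroups of $G$ with $\bigcap_n\Gamma_n=\{1_G\}$. The associated free exact odometer is $X=G_{(\Gamma_n)}=\{(x_n)_n\in\prod_n G/\Gamma_n : x_{n+1}\mapsto x_n \text{ under } G/\Gamma_{n+1}\to G/\Gamma_n \text{ for all } n\}$, a subgroup of the product group with the topology induced by the product of the discrete topologies. The injective homomorphism $\tau:G\to X$, $\tau(g)=(g\Gamma_n)_n$, has dense image, and $\alpha_X$ is the action of $G$ on $X$ given by $\alpha_X^g(x)=\tau(g)x$. $L_X$ and $R_X$ are the left actions of the group $X$ on the space $X$ given by $L_X^{\xi}(x)=\xi x$ and $R_X^{\xi}(x)=x\xi^{-1}$. For an action $\alpha$ of a (not necessarily countable) group $K$ by homeomorphisms on a compact totally disconnected metrizable space $Z$, the topological full group $[[\alpha]]$ is the group of all homeomorphisms $f$ of $Z$ for which there exist a finite clopen partition $\{A_1,\dots,A_k\}$ of $Z$ and $g_1,\dots,g_k\in K$ with $f(y)=\alpha^{g_i}(y)$ for all $y\in A_i$, $1\le i\le k$. For an action $\alpha$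 of a group $G$ on $X$ by homeomorphisms, $\mathrm{Aut}(X,\alpha,G)$ is the group of homeomorphisms $f$ of $X$ with $f\circ\alpha^g=\alpha^g\circ f$ for all $g\in G$. The stabilized automorphism group is $\mathrm{Aut}^\infty(X,\alpha,G)=\bigcup_{K}\mathrm{Aut}(X,\alpha|_K,K)$, the union over all finite-index subgroups $K$ of $G$, where $\alpha|_K$ is the restriction of the action to $K$. *)

theory Defs
  imports "HOL-Algebra.Bij" "HOL-Algebra.Product_Groups" "HOL-Analysis.Analysis"
begin

section \<open>Residual finiteness, scales and amenability\<close>

definition finite_index :: "('a, 'b) monoid_scheme \<Rightarrow> 'a set \<Rightarrow> bool"
  where "finite_index G H \<longleftrightarrow> subgroup H G \<and> finite (rcosets\<^bsub>G\<^esub> H)"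

definition residually_finite :: "('a, 'b) monoid_scheme \<Rightarrow> bool"
  where "residually_finite G \<longleftrightarrow>
    (\<forall>g \<in> carrier G. g \<noteq> \<one>\<^bsub>G\<^esub> \<longrightarrow> (\<exists>N. N \<lhd> G \<and> finite_index G N \<and> g \<notin> N))"

definition subgroup_scale :: "('a, 'b) monoid_scheme \<Rightarrow> (nat \<Rightarrow> 'a set) \<Rightarrow> bool"
  where "subgroup_scale G \<Gamma> \<longleftrightarrow>
    (\<forall>n. \<Gamma> n \<lhd> G \<and> finite_index G (\<Gamma> n)) \<and>
    (\<forall>n. \<Gamma> (Suc n) \<subseteq> \<Gamma> n) \<and>
    (\<Inter>n. \<Gamma> n) = {\<one>\<^bsub>G\<^esub>}"

definition bounded_functions :: "'a set \<Rightarrow> ('a \<Rightarrow> real) set"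
  where "bounded_functions S = {f. \<exists>C. \<forall>x \<in> S. \<bar>f x\<bar> \<le> C}"

text \<open>Amenability of a group as an abstract (discrete) group: there is a left-invariant mean on
  the space of all bounded real functions on the group.  Functions are total on the ambient type;
  linearity and positivity imply that \<open>m f\<close> depends only on the restriction of \<open>f\<close> to
  the carrier.\<close>

definition amenable :: "('a, 'b) monoid_scheme \<Rightarrow> bool"
  where "amenable G \<longleftrightarrow> group G \<and>
    (\<exists>m :: ('a \<Rightarrow> real) \<Rightarrow> real.
      (\<forall>f \<in> bounded_functions (carrier G). \<forall>h \<in> bounded_functions (carrier G).
         m (\<lambda>x. f x + h x) = m f + m h) \<and>
      (\<forall>c. \<forall>f \<in> bounded_functions (carrier G). m (\<lambda>x. c * f x) = c * m f) \<and>
      (\<forall>f \<in> bounded_functions (carrier G). (\<forall>x \<in> carrier G. 0 \<le> f x) \<longrightarrow> 0 \<le> m f) \<and>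
      m (\<lambda>x. 1) = 1 \<and>
      (\<forall>g \<in> carrier G. \<forall>f \<in> bounded_functions (carrier G).
         m (\<lambda>x. f (inv\<^bsub>G\<^esub> g \<otimes>\<^bsub>G\<^esub> x)) = m f))"

section \<open>Free exact odometers\<close>

text \<open>For a normal subgroup \<open>N\<close>, multiplying a coset of a smaller normal subgroup by \<open>N\<close>
  gives the canonical map between the quotients.  The cosets \<open>N #> g\<close> are used by \<open>G Mod N\<close>;
  by normality they are also the cosets \<open>gN\<close>.\<close>

definition coset_projection :: "('a, 'b) monoid_scheme \<Rightarrow> 'a set \<Rightarrow> 'a set \<Rightarrow> 'a set"
  where "coset_projection G N C = N <#>\<^bsub>G\<^esub> C"

lemma coset_projection_rcos:
  assumes "group G" "M \<lhd> G" "N \<lhd> G" "M \<subseteq> N" "g \<in> carrier G"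
  shows "coset_projection G N (M #>\<^bsub>G\<^esub> g) = N #>\<^bsub>G\<^esub> g"
proof -
  interpret group G by fact
  have M: "subgroup M G" and N: "subgroup N G"
    using assms by (auto simp: normal_def)
  have "N <#>\<^bsub>G\<^esub> (M #>\<^bsub>G\<^esub> g) = (N <#>\<^bsub>G\<^esub> M) #>\<^bsub>G\<^esub> g"
    using setmult_rcos_assoc M N assms(5) by (simp add: subgroup.subset)
  also have "N <#>\<^bsub>G\<^esub> M = N"
  proof
    show "N <#>\<^bsub>G\<^esub> M \<subseteq> N"
      using assms(4) subgroup.m_closed[OF N] by (auto simp: set_mult_def)
    show "N \<subseteq> N <#>\<^bsub>G\<^esub> M"
      using subgroup.one_closed[OF M] subgroup.mem_carrier[OF N] by (force simp: set_mult_def)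
  qed
  finally show ?thesis by (simp add: coset_projection_def)
qed

definition odometer :: "('a, 'b) monoid_scheme \<Rightarrow> (nat \<Rightarrow> 'a set) \<Rightarrow> (nat \<Rightarrow> 'a set) monoid"
  where "odometer G \<Gamma> = (product_group UNIV (\<lambda>n. G Mod \<Gamma> n))
    \<lparr>carrier := {x \<in> carrier (product_group UNIV (\<lambda>n. G Mod \<Gamma> n)).
       \<forall>n. coset_projection G (\<Gamma> n) (x (Suc n)) = x n}\<rparr>"

definition odometer_topology :: "('a, 'b) monoid_scheme \<Rightarrow> (nat \<Rightarrow> 'a set) \<Rightarrow> (nat \<Rightarrow> 'a set) topology"
  where "odometer_topology G \<Gamma> =
    subtopology (product_topology (\<lambda>n. discrete_topology (carrier (G Mod \<Gamma> n))) UNIV)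
      (carrier (odometer G \<Gamma>))"

definition odometer_embedding :: "('a, 'b) monoid_scheme \<Rightarrow> (nat \<Rightarrow> 'a set) \<Rightarrow> 'a \<Rightarrow> nat \<Rightarrow> 'a set"
  where "odometer_embedding G \<Gamma> g = (\<lambda>n. \<Gamma> n #>\<^bsub>G\<^esub> g)"

definition odometer_action ::
    "('a, 'b) monoid_scheme \<Rightarrow> (nat \<Rightarrow> 'a set) \<Rightarrow> 'a \<Rightarrow> (nat \<Rightarrow> 'a set) \<Rightarrow> (nat \<Rightarrow> 'a set)"
  where "odometer_action G \<Gamma> g =
    (\<lambda>x \<in> carrier (odometer G \<Gamma>). odometer_embedding G \<Gamma> g \<otimes>\<^bsub>odometer G \<Gamma>\<^esub> x)"

definition left_translation :: "('a, 'b) monoid_scheme \<Rightarrow> 'a \<Rightarrow> 'a \<Rightarrow> 'a"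
  where "left_translation K u = (\<lambda>x \<in> carrier K. u \<otimes>\<^bsub>K\<^esub> x)"

definition right_translation :: "('a, 'b) monoid_scheme \<Rightarrow> 'a \<Rightarrow> 'a \<Rightarrow> 'a"
  where "right_translation K u = (\<lambda>x \<in> carrier K. x \<otimes>\<^bsub>K\<^esub> inv\<^bsub>K\<^esub> u)"

section \<open>Groups of homeomorphisms\<close>

text \<open>Following \<^const>\<open>BijGroup\<close>, self-maps of a space are taken to be extensional,
  so that they are determined by their values on the space.\<close>

definition homeomorphisms :: "'z topology \<Rightarrow> ('z \<Rightarrow> 'z) set"
  where "homeomorphisms T = {f \<in> extensional (topspace T). homeomorphic_map T T f}"

definition topological_full_group ::
    "'z topology \<Rightarrow> ('k, 'b) monoid_scheme \<Rightarrow> ('k \<Rightarrow> 'z \<Rightarrow> 'z) \<Rightarrow> ('z \<Rightarrow> 'z) monoid"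
  where "topological_full_group T K \<alpha> = (BijGroup (topspace T))
    \<lparr>carrier := {f \<in> homeomorphisms T.
       \<exists>\<A> g. finite \<A> \<and> partition_on (topspace T) \<A> \<and>
         (\<forall>A \<in> \<A>. openin T A \<and> closedin T A \<and> g A \<in> carrier K \<and>
            (\<forall>y \<in> A. f y = \<alpha> (g A) y))}\<rparr>"

definition automorphisms :: "'z topology \<Rightarrow> ('k \<Rightarrow> 'z \<Rightarrow> 'z) \<Rightarrow> 'k set \<Rightarrow> ('z \<Rightarrow> 'z) set"
  where "automorphisms T \<alpha> K =
    {f \<in> homeomorphisms T. \<forall>g \<in> K. \<forall>x \<in> topspace T. f (\<alpha> g x) = \<alpha> g (f x)}"

definition stabilized_automorphism_group ::
    "'z topology \<Rightarrow> ('k, 'b) monoid_scheme \<Rightarrow> ('k \<Rightarrow> 'z \<Rightarrow> 'z) \<Rightarrow> ('z \<Rightarrow> 'z) monoid"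
  where "stabilized_automorphism_group T G \<alpha> = (BijGroup (topspace T))
    \<lparr>carrier := (\<Union>K \<in> {K. finite_index G K}. automorphisms T \<alpha> K)\<rparr>"

end

theory Submission
  imports Defs
begin

text \<open>Write \<open>U n\<close> for the open normal subgroup of the odometer \<open>Z\<close> on which the \<open>n\<close>-th coordinate
  is trivial.  By compactness, an element of the topological full group of the right translations is
  given by constant right factors on the cosets of some \<open>U n\<close>; equivalently, it commutes
  with left multiplication by \<open>U n\<close>.  A homeomorphism commuting with a finite-index subgroup of \<open>G\<close>
  commutes with its closure in \<open>Z\<close>, which contains some \<open>U n\<close>, so the stabilized automorphism
  group is the same group.  The bijections commuting with \<open>U n\<close> permute the finitely many
  cosets of \<open>U n\<close>, and those fixing every coset form a finite power of \<open>U n\<close>; hence each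
  stage, and with it the increasing union, is amenable if \<open>Z\<close> is.  Conversely \<open>Z\<close> embeds as
  translations.  Inversion of \<open>Z\<close> exchanges left and right.\<close>

section \<open>Amenability\<close>

text \<open>Amenability is that of discrete groups and the odometer is uncountable, so the arguments
  work with means; the topology serves only to identify the three groups of homeomorphisms. Means
  are moved by one device: a map \<open>r\<close> such that every translation of the target lifts to
  a translation of the source. It need not be a homomorphism, which spares detours. A transversal of
  \<open>V\<close> gives a \<open>V\<close>-equivariant retraction to \<open>V\<close>, hence an
  equivariant map from a finite power of the whole group to the kernel of the coset permutations,
  without treating \<open>V\<close> separately. Evaluation at the identity likewise takes the place
  of restricting a mean to a subgroup of translations. The sides are crossed: left multiplication
  commutes with right factors, so \<open>left_equivariant\<close> belongs to right translations. A
  bijection \<open>f\<close> commuting with left multiplication by \<open>V\<close> acts on the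
  coset of \<open>x\<close> as right multiplication by \<open>inv x \<otimes> f x\<close>. Normality
  makes right multiplication by \<open>V\<close> preserve the right cosets, so on each coset a right
  factor in \<open>V\<close> can be chosen freely.\<close>

definition invariant_mean :: "('a, 'b) monoid_scheme \<Rightarrow> (('a \<Rightarrow> real) \<Rightarrow> real) \<Rightarrow> bool"
  where "invariant_mean G m \<longleftrightarrow>
      (\<forall>f \<in> bounded_functions (carrier G). \<forall>h \<in> bounded_functions (carrier G).
         m (\<lambda>x. f x + h x) = m f + m h) \<and>
      (\<forall>c. \<forall>f \<in> bounded_functions (carrier G). m (\<lambda>x. c * f x) = c * m f) \<and>
      (\<forall>f \<in> bounded_functions (carrier G). (\<forall>x \<in> carrier G. 0 \<le> f x) \<longrightarrow> 0 \<le> m f) \<and>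
      m (\<lambda>x. 1) = 1 \<and>
      (\<forall>g \<in> carrier G. \<forall>f \<in> bounded_functions (carrier G).
         m (\<lambda>x. f (inv\<^bsub>G\<^esub> g \<otimes>\<^bsub>G\<^esub> x)) = m f)"

lemma amenable_iff_invariant_mean: "amenable G \<longleftrightarrow> group G \<and> (\<exists>m. invariant_mean G m)"
  by (simp add: amenable_def invariant_mean_def)

section \<open>Bounded functions and elementary properties of means\<close>

lemma bounded_functionsI: "(\<And>x. x \<in> S \<Longrightarrow> \<bar>f x\<bar> \<le> C) \<Longrightarrow> f \<in> bounded_functions S"
  by (auto simp: bounded_functions_def)

lemma bounded_functions_const [simp]: "(\<lambda>x. c) \<in> bounded_functions S"
  by (rule bounded_functionsI[of _ _ "\<bar>c\<bar>"]) simp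

lemma bounded_functions_add [simp]:
  assumes "f \<in> bounded_functions S" "h \<in> bounded_functions S"
  shows "(\<lambda>x. f x + h x) \<in> bounded_functions S"
proof -
  obtain C D where "\<And>x. x \<in> S \<Longrightarrow> \<bar>f x\<bar> \<le> C" "\<And>x. x \<in> S \<Longrightarrow> \<bar>h x\<bar> \<le> D"
    using assms by (auto simp: bounded_functions_def)
  then show ?thesis
    by (intro bounded_functionsI[of _ _ "C + D"]) force
qed

lemma bounded_functions_scale [simp]:
  assumes "f \<in> bounded_functions S"
  shows "(\<lambda>x. c * f x) \<in> bounded_functions S"
proof -
  obtain C where "\<And>x. x \<in> S \<Longrightarrow> \<bar>f x\<bar> \<le> C"
    using assms by (auto simp: bounded_functions_def)
  then show ?thesis
    by (intro bounded_functionsI[of _ _ "\<bar>c\<bar> * C"]) (simp add: abs_mult mult_left_mono)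
qed

lemma bounded_functions_comp:
  assumes "f \<in> bounded_functions S" "\<And>x. x \<in> R \<Longrightarrow> r x \<in> S"
  shows "(\<lambda>x. f (r x)) \<in> bounded_functions R"
  using assms unfolding bounded_functions_def by blast

lemma bounded_functions_subset:
  "f \<in> bounded_functions S \<Longrightarrow> R \<subseteq> S \<Longrightarrow> f \<in> bounded_functions R"
  by (auto simp: bounded_functions_def)

context
  fixes G :: "('a, 'b) monoid_scheme" and m
  assumes m: "invariant_mean G m"
begin

lemma mean_add:
  "f \<in> bounded_functions (carrier G) \<Longrightarrow> h \<in> bounded_functions (carrier G) \<Longrightarrow>
    m (\<lambda>x. f x + h x) = m f + m h"
  using m by (auto simp: invariant_mean_def)

lemma mean_scale: "f \<in> bounded_functions (carrier G) \<Longrightarrow> m (\<lambda>x. c * f x) = c * m f"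
  using m by (auto simp: invariant_mean_def)

lemma mean_nonneg:
  "f \<in> bounded_functions (carrier G) \<Longrightarrow> (\<And>x. x \<in> carrier G \<Longrightarrow> 0 \<le> f x) \<Longrightarrow> 0 \<le> m f"
  using m by (auto simp: invariant_mean_def)

lemma mean_const: "m (\<lambda>x. c) = c"
proof -
  have "m (\<lambda>x. 1) = 1"
    using m by (auto simp: invariant_mean_def)
  then show ?thesis
    using mean_scale[of "\<lambda>x. 1" c] by simp
qed

lemma mean_invariant:
  "g \<in> carrier G \<Longrightarrow> f \<in> bounded_functions (carrier G) \<Longrightarrow>
    m (\<lambda>x. f (inv\<^bsub>G\<^esub> g \<otimes>\<^bsub>G\<^esub> x)) = m f"
  using m by (auto simp: invariant_mean_def)

text \<open>Positivity applied to the difference, written as \<open>h x + (-1) * f x\<close> to fit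
  additivity and homogeneity.\<close>

lemma mean_mono:
  assumes f: "f \<in> bounded_functions (carrier G)" and h: "h \<in> bounded_functions (carrier G)"
    and le: "\<And>x. x \<in> carrier G \<Longrightarrow> f x \<le> h x"
  shows "m f \<le> m h"
proof -
  have "m (\<lambda>x. h x + (-1) * f x) = m h + m (\<lambda>x. (-1) * f x)"
    by (rule mean_add[OF h bounded_functions_scale[OF f]])
  also have "m (\<lambda>x. (-1) * f x) = (-1) * m f"
    by (rule mean_scale[OF f])
  finally have "m (\<lambda>x. h x + (-1) * f x) = m h + (-1) * m f" .
  moreover have "0 \<le> m (\<lambda>x. h x + (-1) * f x)"
  proof (rule mean_nonneg)
    show "(\<lambda>x. h x + (-1) * f x) \<in> bounded_functions (carrier G)"
      by (rule bounded_functions_add[OF h bounded_functions_scale[OF f]])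
  qed (use le in simp)
  ultimately show ?thesis
    by simp
qed

text \<open>Monotonicity in both directions. This permits rewriting under a mean by identities that
  hold on the carrier only.\<close>

lemma mean_cong:
  assumes "f \<in> bounded_functions (carrier G)" "\<And>x. x \<in> carrier G \<Longrightarrow> f x = h x"
  shows "m f = m h"
proof -
  have "h \<in> bounded_functions (carrier G)"
    using assms by (auto simp: bounded_functions_def)
  then show ?thesis
    using assms by (intro antisym mean_mono) auto
qed

text \<open>Comparison with the constants \<open>C\<close> and \<open>- C\<close>. The bound does
  not depend on the mean, which later confines all the means of an increasing union to one compact
  box.\<close>

lemma mean_abs_le:
  assumes "\<And>x. x \<in> carrier G \<Longrightarrow> \<bar>f x\<bar> \<le> C"
  shows "\<bar>m f\<bar> \<le> C"
proof -
  have f: "f \<in> bounded_functions (carrier G)"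
    using assms by (rule bounded_functionsI)
  have "m f \<le> m (\<lambda>x. C)" "m (\<lambda>x. - C) \<le> m f"
    using assms by (intro mean_mono f; force)+
  then show ?thesis
    by (simp add: mean_const)
qed

lemma mean_translate:
  assumes "group G" "g \<in> carrier G" "f \<in> bounded_functions (carrier G)"
  shows "m (\<lambda>x. f (g \<otimes>\<^bsub>G\<^esub> x)) = m f"
  using mean_invariant[of "inv\<^bsub>G\<^esub> g" f] assms by (simp add: group.inv_inv)

end

text \<open>Both subgroups (with \<open>r\<close> built from a transversal) and quotients (with \<open>r\<close> the projection)
  of amenable groups fall under the following criterion.\<close>

lemma amenable_transfer:
  fixes G :: "('a, 'b) monoid_scheme" and H :: "('c, 'd) monoid_scheme"
  assumes "amenable G" "group H"
    and r: "\<And>x. x \<in> carrier G \<Longrightarrow> r x \<in> carrier H"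
    and equiv: "\<And>h. h \<in> carrier H \<Longrightarrow>
      \<exists>g \<in> carrier G. \<forall>x \<in> carrier G. r (g \<otimes>\<^bsub>G\<^esub> x) = h \<otimes>\<^bsub>H\<^esub> r x"
  shows "amenable H"
proof -
  obtain m where G: "group G" and m: "invariant_mean G m"
    using assms(1) by (auto simp: amenable_iff_invariant_mean)
  have bd: "(\<lambda>x. f (r x)) \<in> bounded_functions (carrier G)"
    if "f \<in> bounded_functions (carrier H)" for f
    using that r by (rule bounded_functions_comp)
  have "invariant_mean H (\<lambda>f. m (\<lambda>x. f (r x)))"
    unfolding invariant_mean_def
  proof (intro conjI ballI allI impI)
    fix h f
    assume h: "h \<in> carrier H" and f: "f \<in> bounded_functions (carrier H)"
    \<comment> \<open>The invariance clause shifts by an inverse, so the translation to be lifted is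
      the one by the inverse of \<open>h\<close>.\<close>
    obtain g where g: "g \<in> carrier G"
      "\<And>x. x \<in> carrier G \<Longrightarrow> r (g \<otimes>\<^bsub>G\<^esub> x) = inv\<^bsub>H\<^esub> h \<otimes>\<^bsub>H\<^esub> r x"
      using equiv[of "inv\<^bsub>H\<^esub> h"] h group.inv_closed[OF \<open>group H\<close>] by blast
    have "m (\<lambda>x. f (r (g \<otimes>\<^bsub>G\<^esub> x))) = m (\<lambda>x. f (inv\<^bsub>H\<^esub> h \<otimes>\<^bsub>H\<^esub> r x))"
    proof (rule mean_cong[OF m])
      show "(\<lambda>x. f (r (g \<otimes>\<^bsub>G\<^esub> x))) \<in> bounded_functions (carrier G)"
        using G g(1) by (intro bounded_functions_comp[OF bd[OF f]]) (simp add: group.is_monoid monoid.m_closed)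
    qed (use g in simp)
    moreover have "m (\<lambda>x. f (r (g \<otimes>\<^bsub>G\<^esub> x))) = m (\<lambda>x. f (r x))"
      by (rule mean_translate[OF m G g(1) bd[OF f]])
    ultimately show "m (\<lambda>x. f (inv\<^bsub>H\<^esub> h \<otimes>\<^bsub>H\<^esub> r x)) = m (\<lambda>x. f (r x))"
      by simp
  qed (auto simp: bd r mean_add[OF m] mean_scale[OF m] mean_const[OF m] intro!: mean_nonneg[OF m])
  then show ?thesis
    using \<open>group H\<close> by (auto simp: amenable_iff_invariant_mean)
qed

text \<open>The iterated mean: average over \<open>H\<close> for fixed first coordinate, then over
  \<open>G\<close>. The order of the two means is never exchanged: the inner one absorbs the shift
  by \<open>b\<close>, after which the outer one absorbs the shift by \<open>a\<close>.\<close>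

lemma amenable_DirProd:
  fixes G :: "('a, 'b) monoid_scheme" and H :: "('c, 'd) monoid_scheme"
  assumes "amenable G" "amenable H"
  shows "amenable (G \<times>\<times> H)"
proof -
  obtain m k where G: "group G" and m: "invariant_mean G m" and H: "group H" and k: "invariant_mean H k"
    using assms by (auto simp: amenable_iff_invariant_mean)
  interpret G: group G by (fact G)
  interpret H: group H by (fact H)
  let ?B = "bounded_functions (carrier (G \<times>\<times> H))"
  have in_bd: "(\<lambda>h. f (g, h)) \<in> bounded_functions (carrier H)" if "f \<in> ?B" "g \<in> carrier G" for f g
    using that by (auto intro: bounded_functions_comp)
  have out_bd: "(\<lambda>g. k (\<lambda>h. f (g, h))) \<in> bounded_functions (carrier G)" if "f \<in> ?B" for f
  proof -
    obtain C where C: "\<And>x. x \<in> carrier (G \<times>\<times> H) \<Longrightarrow> \<bar>f x\<bar> \<le> C"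
      using \<open>f \<in> ?B\<close> by (auto simp: bounded_functions_def)
    show ?thesis
      by (rule bounded_functionsI[of _ _ C], rule mean_abs_le[OF k]) (simp add: C)
  qed
  have "invariant_mean (G \<times>\<times> H) (\<lambda>f. m (\<lambda>g. k (\<lambda>h. f (g, h))))"
    unfolding invariant_mean_def
  proof (intro conjI ballI allI impI)
    fix f f' assume f: "f \<in> ?B" and f': "f' \<in> ?B"
    \<comment> \<open>Linearity of the inner mean is available only for \<open>g\<close> in the
      carrier, hence the passage through \<open>mean_cong\<close>.\<close>
    have "m (\<lambda>g. k (\<lambda>h. f (g, h) + f' (g, h))) = m (\<lambda>g. k (\<lambda>h. f (g, h)) + k (\<lambda>h. f' (g, h)))"
      using out_bd[OF bounded_functions_add[OF f f']] in_bd[OF f] in_bd[OF f']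
      by (intro mean_cong[OF m]) (auto simp: mean_add[OF k])
    then show "m (\<lambda>g. k (\<lambda>h. f (g, h) + f' (g, h))) = m (\<lambda>g. k (\<lambda>h. f (g, h))) + m (\<lambda>g. k (\<lambda>h. f' (g, h)))"
      by (simp only: mean_add[OF m out_bd[OF f] out_bd[OF f']])
  next
    fix c f assume f: "f \<in> ?B"
    have "m (\<lambda>g. k (\<lambda>h. c * f (g, h))) = m (\<lambda>g. c * k (\<lambda>h. f (g, h)))"
      using out_bd[OF bounded_functions_scale[OF f]] in_bd[OF f]
      by (intro mean_cong[OF m]) (auto simp: mean_scale[OF k])
    then show "m (\<lambda>g. k (\<lambda>h. c * f (g, h))) = c * m (\<lambda>g. k (\<lambda>h. f (g, h)))"
      by (simp only: mean_scale[OF m out_bd[OF f]])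
  next
    fix f assume f: "f \<in> ?B" and nn: "\<forall>x \<in> carrier (G \<times>\<times> H). 0 \<le> f x"
    show "0 \<le> m (\<lambda>g. k (\<lambda>h. f (g, h)))"
      using nn by (intro mean_nonneg[OF m] mean_nonneg[OF k] out_bd in_bd f) auto
  next
    fix z f assume z: "z \<in> carrier (G \<times>\<times> H)" and f: "f \<in> ?B"
    obtain a b where ab: "z = (a, b)" "a \<in> carrier G" "b \<in> carrier H"
      using z by auto
    have "m (\<lambda>g. k (\<lambda>h. f (inv\<^bsub>G\<^esub> a \<otimes>\<^bsub>G\<^esub> g, inv\<^bsub>H\<^esub> b \<otimes>\<^bsub>H\<^esub> h)))
        = m (\<lambda>g. k (\<lambda>h. f (inv\<^bsub>G\<^esub> a \<otimes>\<^bsub>G\<^esub> g, h)))"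
    proof (rule mean_cong[OF m])
      show "(\<lambda>g. k (\<lambda>h. f (inv\<^bsub>G\<^esub> a \<otimes>\<^bsub>G\<^esub> g, inv\<^bsub>H\<^esub> b \<otimes>\<^bsub>H\<^esub> h))) \<in> bounded_functions (carrier G)"
        using ab by (intro out_bd[of "\<lambda>(g, h). f (inv\<^bsub>G\<^esub> a \<otimes>\<^bsub>G\<^esub> g, inv\<^bsub>H\<^esub> b \<otimes>\<^bsub>H\<^esub> h)", simplified])
          (auto simp: case_prod_unfold intro: bounded_functions_comp[OF f])
    next
      fix g assume "g \<in> carrier G"
      then show "k (\<lambda>h. f (inv\<^bsub>G\<^esub> a \<otimes>\<^bsub>G\<^esub> g, inv\<^bsub>H\<^esub> b \<otimes>\<^bsub>H\<^esub> h)) = k (\<lambda>h. f (inv\<^bsub>G\<^esub> a \<otimes>\<^bsub>G\<^esub> g, h))"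
        using ab by (intro mean_invariant[OF k, of b "\<lambda>h. f (inv\<^bsub>G\<^esub> a \<otimes>\<^bsub>G\<^esub> g, h)"] in_bd f) auto
    qed
    also have "\<dots> = m (\<lambda>g. k (\<lambda>h. f (g, h)))"
      by (rule mean_invariant[OF m ab(2) out_bd[OF f]])
    finally have *: "m (\<lambda>g. k (\<lambda>h. f (inv\<^bsub>G\<^esub> a \<otimes>\<^bsub>G\<^esub> g, inv\<^bsub>H\<^esub> b \<otimes>\<^bsub>H\<^esub> h))) = m (\<lambda>g. k (\<lambda>h. f (g, h)))" .
    then show "m (\<lambda>g. k (\<lambda>h. f (inv\<^bsub>G \<times>\<times> H\<^esub> z \<otimes>\<^bsub>G \<times>\<times> H\<^esub> (g, h)))) = m (\<lambda>g. k (\<lambda>h. f (g, h)))"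
      using ab G H by (simp add: inv_DirProd)
  qed (auto simp: mean_const[OF m] mean_const[OF k])
  then show ?thesis
    using DirProd_group[OF G H] by (auto simp: amenable_iff_invariant_mean)
qed

lemma amenable_trivial:
  assumes "group G" "carrier G = {\<one>\<^bsub>G\<^esub>}"
  shows "amenable G"
proof -
  interpret group G by (fact assms(1))
  have "invariant_mean G (\<lambda>f. f \<one>\<^bsub>G\<^esub>)"
    using assms(2) by (auto simp: invariant_mean_def)
  then show ?thesis
    using \<open>group G\<close> by (auto simp: amenable_iff_invariant_mean)
qed

lemma amenable_finite_product:
  assumes "finite I" "\<And>i. i \<in> I \<Longrightarrow> amenable (G i)"
  shows "amenable (product_group I G)"
  using assms
proof (induction I rule: finite_induct)
  case empty
  show ?case
    by (rule amenable_trivial, rule product_group) auto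
next
  case (insert i I)
  have gr: "\<And>j. j \<in> insert i I \<Longrightarrow> group (G j)"
    using insert.prems by (auto simp: amenable_iff_invariant_mean)
  have "amenable (G i \<times>\<times> product_group I G)"
    using insert by (intro amenable_DirProd) auto
  then show ?case
  \<comment> \<open>Adjoining the coordinate \<open>i\<close> identifies the binary product with the
    larger finite product; translations lift by splitting off that coordinate.\<close>
  proof (rule amenable_transfer[where r = "\<lambda>(a, x). x(i := a)"])
    show "group (product_group (insert i I) G)"
      using gr by (rule product_group)
  next
    fix z assume "z \<in> carrier (G i \<times>\<times> product_group I G)"
    then show "(case z of (a, x) \<Rightarrow> x(i := a)) \<in> carrier (product_group (insert i I) G)"
      by (auto simp: PiE_insert_eq)
  next
    fix h assume h: "h \<in> carrier (product_group (insert i I) G)"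
    show "\<exists>g\<in>carrier (G i \<times>\<times> product_group I G). \<forall>z\<in>carrier (G i \<times>\<times> product_group I G).
            (case g \<otimes>\<^bsub>G i \<times>\<times> product_group I G\<^esub> z of (a, x) \<Rightarrow> x(i := a))
              = h \<otimes>\<^bsub>product_group (insert i I) G\<^esub> (case z of (a, x) \<Rightarrow> x(i := a))"
    proof (intro bexI ballI)
      show "(h i, restrict h I) \<in> carrier (G i \<times>\<times> product_group I G)"
        using h by auto
      fix z assume "z \<in> carrier (G i \<times>\<times> product_group I G)"
      then show "(case (h i, restrict h I) \<otimes>\<^bsub>G i \<times>\<times> product_group I G\<^esub> z of (a, x) \<Rightarrow> x(i := a))
              = h \<otimes>\<^bsub>product_group (insert i I) G\<^esub> (case z of (a, x) \<Rightarrow> x(i := a))"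
        using \<open>i \<notin> I\<close> by (auto simp: fun_eq_iff)
    qed
  qed
qed

text \<open>\<open>G\<close> is a finite disjoint union of left cosets of \<open>K\<close>. The mean
  of \<open>K\<close> is carried to each of them and the results are averaged. Left invariance under
  \<open>K\<close> makes each summand independent of the representative, and a translation by
  \<open>G\<close> merely permutes the summands.\<close>

lemma amenable_finite_index_overgroup:
  fixes G :: "('a, 'b) monoid_scheme"
  assumes "group G" "finite_index G K" "amenable (G\<lparr>carrier := K\<rparr>)"
  shows "amenable G"
proof -
  interpret group G by (fact assms(1))
  have K: "subgroup K G" and fin: "finite (rcosets\<^bsub>G\<^esub> K)"
    using assms(2) by (auto simp: finite_index_def)
  interpret K: subgroup K G by (fact K)
  let ?K = "G\<lparr>carrier := K\<rparr>"
  let ?B = "bounded_functions (carrier G)"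
  obtain k where k: "invariant_mean ?K k"
    using assms(3) by (auto simp: amenable_iff_invariant_mean)
  define \<rho> where "\<rho> = (\<lambda>C :: 'a set. SOME c. c \<in> C)"
  have \<rho>_in: "\<rho> C \<in> C" if "C \<in> rcosets\<^bsub>G\<^esub> K" for C
    using that rcos_self[OF _ K] unfolding \<rho>_def by (auto simp: RCOSETS_def some_in_eq)
  have \<rho>: "\<rho> C \<in> carrier G" and \<rho>_eq: "C = K #>\<^bsub>G\<^esub> \<rho> C" if C: "C \<in> rcosets\<^bsub>G\<^esub> K" for C
  proof -
    show "\<rho> C \<in> carrier G"
      using \<rho>_in[OF C] rcosets_part_G[OF K] C by blast
    obtain x where "x \<in> carrier G" "C = K #>\<^bsub>G\<^esub> x"
      using C by (auto simp: RCOSETS_def)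
    then show "C = K #>\<^bsub>G\<^esub> \<rho> C"
      using repr_independence[of "\<rho> C" K x] \<rho>_in[OF C] K by simp
  qed
  define N where "N = real (card (rcosets\<^bsub>G\<^esub> K))"
  have "K #>\<^bsub>G\<^esub> \<one>\<^bsub>G\<^esub> \<in> rcosets\<^bsub>G\<^esub> K"
    using rcosetsI[OF K.subset] by blast
  then have "N > 0"
    using fin by (auto simp: N_def card_gt_0_iff)
  \<comment> \<open>The left coset used is \<open>inv (\<rho> C) K\<close>, the set of inverses of
    the right coset \<open>C\<close>. A change of representative by an element of \<open>K\<close>
    becomes a left translation in the argument of \<open>k\<close>.\<close>
  define p where "p = (\<lambda>f C. k (\<lambda>n. f (inv\<^bsub>G\<^esub> (\<rho> C) \<otimes>\<^bsub>G\<^esub> n)))"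
  define m where "m = (\<lambda>f. (\<Sum>C \<in> rcosets\<^bsub>G\<^esub> K. p f C) / N)"
  have bd: "(\<lambda>n. f (g \<otimes>\<^bsub>G\<^esub> n)) \<in> bounded_functions (carrier ?K)" if "f \<in> ?B" "g \<in> carrier G" for f g
    using that by (intro bounded_functions_comp[where r = "\<lambda>n. g \<otimes>\<^bsub>G\<^esub> n" and S = "carrier G"]) auto
  have bdp: "(\<lambda>n. f (inv\<^bsub>G\<^esub> (\<rho> C) \<otimes>\<^bsub>G\<^esub> n)) \<in> bounded_functions (carrier ?K)" if "f \<in> ?B" "C \<in> rcosets\<^bsub>G\<^esub> K" for f C
    using that by (intro bd) (auto simp: \<rho>)
  have "invariant_mean G m"
    unfolding invariant_mean_def
  proof (intro conjI ballI allI impI)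
    fix f h assume "f \<in> ?B" "h \<in> ?B"
    then have "p (\<lambda>x. f x + h x) C = p f C + p h C" if "C \<in> rcosets\<^bsub>G\<^esub> K" for C
      unfolding p_def using that by (intro mean_add[OF k bdp bdp])
    then show "m (\<lambda>x. f x + h x) = m f + m h"
      by (simp add: m_def sum.distrib add_divide_distrib)
  next
    fix c f assume "f \<in> ?B"
    then have "p (\<lambda>x. c * f x) C = c * p f C" if "C \<in> rcosets\<^bsub>G\<^esub> K" for C
      unfolding p_def using that by (intro mean_scale[OF k bdp])
    then show "m (\<lambda>x. c * f x) = c * m f"
      by (simp add: m_def sum_distrib_left)
  next
    fix f assume "f \<in> ?B" and nn: "\<forall>x\<in>carrier G. 0 \<le> f x"
    then have "0 \<le> p f C" if "C \<in> rcosets\<^bsub>G\<^esub> K" for C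
      unfolding p_def using that by (intro mean_nonneg[OF k] bdp) (auto simp: \<rho>)
    then show "0 \<le> m f"
      using \<open>N > 0\<close> by (simp add: m_def sum_nonneg)
  next
    show "m (\<lambda>x. 1) = 1"
      using \<open>N > 0\<close> by (simp add: m_def p_def mean_const[OF k] N_def)
  next
    fix g f assume g: "g \<in> carrier G" and f: "f \<in> ?B"
    \<comment> \<open>Shifting by \<open>inv g\<close> turns \<open>inv (\<rho> C)\<close> into the
      inverse of \<open>\<rho> C \<otimes> g\<close>, so the summand of \<open>C\<close> becomes
      that of the coset of \<open>\<rho> C \<otimes> g\<close>.\<close>
    let ?s = "\<lambda>C. C #>\<^bsub>G\<^esub> g"
    have s_in: "?s C \<in> rcosets\<^bsub>G\<^esub> K" if "C \<in> rcosets\<^bsub>G\<^esub> K" for C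
      using that g K.subset by (auto simp: RCOSETS_def coset_mult_assoc)
    have s_inj: "inj_on ?s (rcosets\<^bsub>G\<^esub> K)"
    proof (rule inj_onI)
      fix C D assume CD: "C \<in> rcosets\<^bsub>G\<^esub> K" "D \<in> rcosets\<^bsub>G\<^esub> K" "?s C = ?s D"
      have "C \<subseteq> carrier G" "D \<subseteq> carrier G"
        using CD rcosets_part_G[OF K] by blast+
      then have "?s C #>\<^bsub>G\<^esub> inv\<^bsub>G\<^esub> g = C" "?s D #>\<^bsub>G\<^esub> inv\<^bsub>G\<^esub> g = D"
        using g by (simp_all add: coset_mult_assoc coset_mult_one)
      then show "C = D"
        using CD(3) by metis
    qed
    have s_img: "?s ` (rcosets\<^bsub>G\<^esub> K) = rcosets\<^bsub>G\<^esub> K"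
      by (rule endo_inj_surj[OF fin _ s_inj]) (use s_in in blast)
    \<comment> \<open>\<open>\<rho> C \<otimes> g\<close> need not be the chosen representative of
      its coset; the discrepancy \<open>n\<close> lies in \<open>K\<close> and is absorbed by
      invariance of \<open>k\<close>.\<close>
    have step: "p (\<lambda>x. f (inv\<^bsub>G\<^esub> g \<otimes>\<^bsub>G\<^esub> x)) C = p f (?s C)" if C: "C \<in> rcosets\<^bsub>G\<^esub> K" for C
    proof -
      let ?D = "?s C"
      have D: "?D \<in> rcosets\<^bsub>G\<^esub> K"
        using s_in C by simp
      have "\<rho> C \<otimes>\<^bsub>G\<^esub> g \<in> ?D"
        using \<rho>_in[OF C] by (auto simp: r_coset_def)
      then have "\<rho> C \<otimes>\<^bsub>G\<^esub> g \<in> K #>\<^bsub>G\<^esub> \<rho> ?D"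
        using \<rho>_eq[OF D] by blast
      then obtain n where n: "n \<in> K" "\<rho> C \<otimes>\<^bsub>G\<^esub> g = n \<otimes>\<^bsub>G\<^esub> \<rho> ?D"
        by (auto simp: r_coset_def)
      have nG: "n \<in> carrier G"
        using n(1) by simp
      have "inv\<^bsub>G\<^esub> g \<otimes>\<^bsub>G\<^esub> inv\<^bsub>G\<^esub> \<rho> C = inv\<^bsub>G\<^esub> \<rho> ?D \<otimes>\<^bsub>G\<^esub> inv\<^bsub>G\<^esub> n"
        using arg_cong[OF n(2), of "\<lambda>x. inv\<^bsub>G\<^esub> x"] g \<rho>[OF C] \<rho>[OF D] nG by (simp add: inv_mult_group)
      then have "f (inv\<^bsub>G\<^esub> \<rho> ?D \<otimes>\<^bsub>G\<^esub> (inv\<^bsub>?K\<^esub> n \<otimes>\<^bsub>?K\<^esub> x)) = f (inv\<^bsub>G\<^esub> g \<otimes>\<^bsub>G\<^esub> (inv\<^bsub>G\<^esub> \<rho> C \<otimes>\<^bsub>G\<^esub> x))"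
        if "x \<in> K" for x
        using that g \<rho>[OF C] \<rho>[OF D] nG n(1) K by (simp add: m_assoc[symmetric] m_inv_consistent)
      moreover have "(\<lambda>x. f (inv\<^bsub>G\<^esub> \<rho> ?D \<otimes>\<^bsub>G\<^esub> (inv\<^bsub>?K\<^esub> n \<otimes>\<^bsub>?K\<^esub> x))) \<in> bounded_functions (carrier ?K)"
        using n(1) K by (intro bounded_functions_comp[OF bdp[OF f D]]) (simp add: m_inv_consistent)
      ultimately have "p (\<lambda>x. f (inv\<^bsub>G\<^esub> g \<otimes>\<^bsub>G\<^esub> x)) C = k (\<lambda>x. f (inv\<^bsub>G\<^esub> \<rho> ?D \<otimes>\<^bsub>G\<^esub> (inv\<^bsub>?K\<^esub> n \<otimes>\<^bsub>?K\<^esub> x)))"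
        unfolding p_def by (intro mean_cong[OF k, symmetric]) auto
      also have "\<dots> = p f ?D"
        unfolding p_def using n(1) by (intro mean_invariant[OF k, of _ "\<lambda>x. f (inv\<^bsub>G\<^esub> \<rho> ?D \<otimes>\<^bsub>G\<^esub> x)"] bdp f D) simp
      finally show ?thesis .
    qed
    have "(\<Sum>C \<in> rcosets\<^bsub>G\<^esub> K. p (\<lambda>x. f (inv\<^bsub>G\<^esub> g \<otimes>\<^bsub>G\<^esub> x)) C) = (\<Sum>C \<in> rcosets\<^bsub>G\<^esub> K. p f (?s C))"
      using step by (rule sum.cong[OF refl])
    also have "\<dots> = (\<Sum>C \<in> rcosets\<^bsub>G\<^esub> K. p f C)"
      using sum.reindex[OF s_inj, of "p f"] s_img by simp
    finally show "m (\<lambda>x. f (inv\<^bsub>G\<^esub> g \<otimes>\<^bsub>G\<^esub> x)) = m f"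
      by (simp add: m_def)
  qed
  then show ?thesis
    using \<open>group G\<close> by (auto simp: amenable_iff_invariant_mean)
qed

text \<open>A cluster point, in the compact space of functionals dominated by the supremum norm, of
  invariant means of the subgroups is an invariant mean of their union.\<close>

lemma amenable_increasing_union:
  fixes G :: "('a, 'b) monoid_scheme"
  assumes "group G"
    and sub: "\<And>n. subgroup (H n) G" and mono: "\<And>n. H n \<subseteq> H (Suc n)"
    and union: "carrier G = (\<Union>n. H n)"
    and am: "\<And>n. amenable (G\<lparr>carrier := H n\<rparr>)"
  shows "amenable G"
proof -
  interpret group G by (fact assms(1))
  let ?B = "bounded_functions (carrier G)"
  have "\<exists>m. invariant_mean (G\<lparr>carrier := H n\<rparr>) m" for n
    using am[of n] by (simp add: amenable_iff_invariant_mean)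
  then obtain m where m: "\<And>n. invariant_mean (G\<lparr>carrier := H n\<rparr>) (m n)"
    by metis
  have H_sub: "H n \<subseteq> carrier G" for n
    using union by blast
  have bd: "f \<in> bounded_functions (carrier (G\<lparr>carrier := H n\<rparr>))" if "f \<in> ?B" for f n
    using bounded_functions_subset[OF that H_sub[of n]] by simp
  \<comment> \<open>The value 0 off the bounded functions makes every coordinate of
    \<open>M n\<close> bounded, including those about which an invariant mean says nothing.\<close>
  define M where "M = (\<lambda>n f. if f \<in> ?B then m n f else 0)"
  \<comment> \<open>One bound per function on all of \<open>G\<close>, hence valid simultaneously
    for the means of all the \<open>H n\<close>.\<close>
  have "\<exists>C. \<forall>f \<in> ?B. \<forall>x \<in> carrier G. \<bar>f x\<bar> \<le> (C f :: real)"
    unfolding bounded_functions_def by (rule exI[of _ "\<lambda>f. SOME C. \<forall>x \<in> carrier G. \<bar>f x\<bar> \<le> C"])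
      (auto intro: someI2_ex)
  then obtain C :: "('a \<Rightarrow> real) \<Rightarrow> real" where C: "\<And>f x. f \<in> ?B \<Longrightarrow> x \<in> carrier G \<Longrightarrow> \<bar>f x\<bar> \<le> C f"
    by blast
  have M_le: "\<bar>M n f\<bar> \<le> \<bar>C f\<bar>" for n f
  proof (cases "f \<in> ?B")
    case True
    have "\<bar>m n f\<bar> \<le> C f"
      using C[OF True] H_sub[of n] by (intro mean_abs_le[OF m]) auto
    then show ?thesis
      using True by (simp add: M_def)
  qed (simp add: M_def)
  \<comment> \<open>A product of compact intervals indexed by all functions: Tychonoff gives a
    cluster point \<open>\<mu>\<close> of the sequence, though not a convergent subsequence.\<close>
  let ?P = "PiE UNIV (\<lambda>f. {-\<bar>C f\<bar>..\<bar>C f\<bar>})"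
  have "compactin (product_topology (\<lambda>f. euclidean) UNIV) ?P"
    by (subst compactin_PiE) auto
  then have "compact ?P"
    by (simp add: euclidean_product_topology)
  moreover have "M n \<in> ?P" for n
    using M_le[of n] by (auto simp: abs_le_iff minus_le_iff)
  then have "eventually (\<lambda>\<mu>. \<mu> \<in> ?P) (filtermap M sequentially)"
    by (simp add: eventually_filtermap)
  moreover have "filtermap M sequentially \<noteq> bot"
    by (simp add: filtermap_bot_iff)
  ultimately obtain \<mu> where \<mu>: "inf (nhds \<mu>) (filtermap M sequentially) \<noteq> bot"
    unfolding compact_filter by blast
  \<comment> \<open>A closed condition that fails at \<open>\<mu>\<close> fails in a whole
    neighbourhood, so it cannot hold along a tail of the sequence. Each clause below is closed since
    it involves finitely many coordinates of the functional.\<close>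
  have limit: "P \<mu>" if "closed {\<nu>. P \<nu>}" "\<forall>\<^sub>F n in sequentially. P (M n)" for P
  proof (rule ccontr)
    assume "\<not> P \<mu>"
    then have "eventually (\<lambda>\<nu>. \<not> P \<nu>) (nhds \<mu>)"
      using that(1) by (intro eventually_nhds_in_open[of "- {\<nu>. P \<nu>}", simplified]) auto
    moreover have "eventually P (filtermap M sequentially)"
      using that(2) by (simp add: eventually_filtermap)
    ultimately have "eventually (\<lambda>_. False) (inf (nhds \<mu>) (filtermap M sequentially))"
      unfolding eventually_inf by (intro exI[of _ "\<lambda>\<nu>. \<not> P \<nu>"] exI[of _ P]) auto
    then show False
      using \<mu> by (simp add: trivial_limit_def)
  qed
  have "invariant_mean G \<mu>"
    unfolding invariant_mean_def
  proof (intro conjI ballI allI impI)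
    fix f h assume fh: "f \<in> ?B" "h \<in> ?B"
    show "\<mu> (\<lambda>x. f x + h x) = \<mu> f + \<mu> h"
      by (rule limit, intro closed_Collect_eq continuous_intros continuous_on_product_coordinates)
        (use fh in \<open>simp add: M_def mean_add[OF m bd bd]\<close>)
  next
    fix c f assume f: "f \<in> ?B"
    show "\<mu> (\<lambda>x. c * f x) = c * \<mu> f"
      by (rule limit, intro closed_Collect_eq continuous_intros continuous_on_product_coordinates)
        (use f in \<open>simp add: M_def mean_scale[OF m bd]\<close>)
  next
    fix f assume f: "f \<in> ?B" and nn: "\<forall>x\<in>carrier G. 0 \<le> f x"
    have "0 \<le> m n f" for n
      using nn H_sub[of n] by (intro mean_nonneg[OF m] bd f) auto
    then show "0 \<le> \<mu> f"
      by (intro limit[of "\<lambda>\<nu>. 0 \<le> \<nu> f"] closed_Collect_le continuous_intros continuous_on_product_coordinates) (simp add: M_def)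
  next
    show "\<mu> (\<lambda>x. 1) = 1"
      by (rule limit, intro closed_Collect_eq continuous_intros continuous_on_product_coordinates)
        (simp add: M_def mean_const[OF m])
  next
    fix g f assume g: "g \<in> carrier G" and f: "f \<in> ?B"
    have f': "(\<lambda>x. f (inv\<^bsub>G\<^esub> g \<otimes>\<^bsub>G\<^esub> x)) \<in> ?B"
      using g by (intro bounded_functions_comp[OF f]) auto
    \<comment> \<open>Invariance under \<open>g\<close> holds only for the means of those stages
      that contain \<open>g\<close>; a tail suffices for \<open>limit\<close>.\<close>
    obtain n where "g \<in> H n"
      using g union by blast
    then have gH: "g \<in> H j" if "n \<le> j" for j
      using that mono lift_Suc_mono_le[of H n j] by blast
    have "m j (\<lambda>x. f (inv\<^bsub>G\<^esub> g \<otimes>\<^bsub>G\<^esub> x)) = m j f" if "n \<le> j" for j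
      using mean_invariant[OF m, of g j f] gH[OF that] bd[OF f, of j] sub[of j]
      by (simp add: m_inv_consistent)
    then show "\<mu> (\<lambda>x. f (inv\<^bsub>G\<^esub> g \<otimes>\<^bsub>G\<^esub> x)) = \<mu> f"
      by (intro limit[of "\<lambda>\<nu>. \<nu> (\<lambda>x. f (inv\<^bsub>G\<^esub> g \<otimes>\<^bsub>G\<^esub> x)) = \<nu> f"] closed_Collect_eq continuous_intros continuous_on_product_coordinates
        eventually_sequentiallyI[of n]) (simp add: M_def f f')
  qed
  then show ?thesis
    using \<open>group G\<close> by (auto simp: amenable_iff_invariant_mean)
qed

section \<open>Equivariant bijections\<close>

lemma BijGroup_simps:
  "carrier (BijGroup S) = Bij S"
  "\<one>\<^bsub>BijGroup S\<^esub> = (\<lambda>x \<in> S. x)"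
  "f \<in> Bij S \<Longrightarrow> g \<in> Bij S \<Longrightarrow> f \<otimes>\<^bsub>BijGroup S\<^esub> g = compose S f g"
  by (simp_all add: BijGroup_def)

lemma Bij_mem: "f \<in> Bij S \<Longrightarrow> x \<in> S \<Longrightarrow> f x \<in> S"
  using Bij_imp_funcset by blast

lemma Bij_ext: "f \<in> Bij S \<Longrightarrow> g \<in> Bij S \<Longrightarrow> (\<And>x. x \<in> S \<Longrightarrow> f x = g x) \<Longrightarrow> f = g"
  by (rule extensionalityI[where A = S]) (auto dest: Bij_imp_extensional)

lemma BijI:
  assumes "f \<in> extensional S" "\<And>x. x \<in> S \<Longrightarrow> f x \<in> S" "\<And>x. x \<in> S \<Longrightarrow> g x \<in> S"
    "\<And>x. x \<in> S \<Longrightarrow> g (f x) = x" "\<And>x. x \<in> S \<Longrightarrow> f (g x) = x"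
  shows "f \<in> Bij S"
  using assms by (auto simp: Bij_def intro!: bij_betw_byWitness[where f' = g])

lemma Bij_inverse:
  assumes "f \<in> Bij S" "x \<in> S"
  shows "(inv\<^bsub>BijGroup S\<^esub> f) x \<in> S" "(inv\<^bsub>BijGroup S\<^esub> f) (f x) = x" "f ((inv\<^bsub>BijGroup S\<^esub> f) x) = x"
proof -
  have "bij_betw f S S"
    using assms(1) by (simp add: Bij_def)
  then show "(inv\<^bsub>BijGroup S\<^esub> f) x \<in> S" "(inv\<^bsub>BijGroup S\<^esub> f) (f x) = x" "f ((inv\<^bsub>BijGroup S\<^esub> f) x) = x"
    using assms Bij_inv_into_mem[OF assms] Bij_mem[OF assms]
    by (simp_all add: inv_BijGroup bij_betw_inv_into_left bij_betw_inv_into_right)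
qed

text \<open>For \<open>V = carrier X\<close> in a group \<open>X\<close> these are exactly the right
  translations. For a smaller subgroup \<open>V\<close> the right factor may vary from one right
  coset of \<open>V\<close> to another.\<close>

definition left_equivariant :: "('a, 'b) monoid_scheme \<Rightarrow> 'a set \<Rightarrow> ('a \<Rightarrow> 'a) set"
  where "left_equivariant X V =
    {f \<in> Bij (carrier X). \<forall>u \<in> V. \<forall>x \<in> carrier X. f (u \<otimes>\<^bsub>X\<^esub> x) = u \<otimes>\<^bsub>X\<^esub> f x}"

definition right_equivariant :: "('a, 'b) monoid_scheme \<Rightarrow> 'a set \<Rightarrow> ('a \<Rightarrow> 'a) set"
  where "right_equivariant X V =
    {f \<in> Bij (carrier X). \<forall>u \<in> V. \<forall>x \<in> carrier X. f (x \<otimes>\<^bsub>X\<^esub> u) = f x \<otimes>\<^bsub>X\<^esub> u}"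

text \<open>Stated for arbitrary self-maps \<open>a i\<close> so as to serve both left and right
  multiplications. For inverses, \<open>x\<close> is rewritten as the image of its preimage.\<close>

lemma subgroup_BijGroup_commuting:
  assumes "\<And>i x. i \<in> I \<Longrightarrow> x \<in> S \<Longrightarrow> a i x \<in> S"
  shows "subgroup {f \<in> Bij S. \<forall>i \<in> I. \<forall>x \<in> S. f (a i x) = a i (f x)} (BijGroup S)" (is "subgroup ?H _")
proof (rule group.subgroupI[OF group_BijGroup])
  show "?H \<subseteq> carrier (BijGroup S)"
    by (auto simp: BijGroup_simps)
  have "(\<lambda>x \<in> S. x) \<in> ?H"
    using assms by (auto simp: id_Bij)
  then show "?H \<noteq> {}"
    by blast
next
  fix f assume f: "f \<in> ?H"
  let ?g = "inv\<^bsub>BijGroup S\<^esub> f"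
  have "?g \<in> Bij S"
    using f group.inv_closed[OF group_BijGroup, of f S] by (simp add: BijGroup_simps)
  moreover have "?g (a i x) = a i (?g x)" if "i \<in> I" "x \<in> S" for i x
  proof -
    have "?g (a i x) = ?g (a i (f (?g x)))"
      using f that by (simp add: Bij_inverse)
    also have "\<dots> = ?g (f (a i (?g x)))"
      using f that by (simp add: Bij_inverse)
    also have "\<dots> = a i (?g x)"
      using f that assms by (intro Bij_inverse(2)) (simp_all add: Bij_inverse)
    finally show ?thesis .
  qed
  ultimately show "?g \<in> ?H"
    by blast
next
  fix f g assume "f \<in> ?H" "g \<in> ?H"
  then show "f \<otimes>\<^bsub>BijGroup S\<^esub> g \<in> ?H"
    using assms by (auto simp: BijGroup_simps compose_Bij compose_eq Bij_mem)
qed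

section \<open>Equivariant bijections relative to a subgroup\<close>

context group
begin

lemma subgroup_left_equivariant:
  "V \<subseteq> carrier G \<Longrightarrow> subgroup (left_equivariant G V) (BijGroup (carrier G))"
  unfolding left_equivariant_def
  by (rule subgroup_BijGroup_commuting[where a = "\<lambda>u x. u \<otimes> x"]) auto

lemma subgroup_right_equivariant:
  "V \<subseteq> carrier G \<Longrightarrow> subgroup (right_equivariant G V) (BijGroup (carrier G))"
  unfolding right_equivariant_def
  by (rule subgroup_BijGroup_commuting[where a = "\<lambda>u x. x \<otimes> u"]) auto

lemma rcos_eq_iff:
  assumes "subgroup V G" "x \<in> carrier G" "y \<in> carrier G"
  shows "V #> x = V #> y \<longleftrightarrow> x \<otimes> inv y \<in> V"
proof -
  have "V #> x = V #> y \<longleftrightarrow> x \<in> V #> y"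
    using assms repr_independence repr_independenceD by metis
  then show ?thesis
    using subgroup.rcos_module[OF assms(1) is_group assms(3,2)] by simp
qed

lemma rcos_mult_left:
  assumes "subgroup V G" "v \<in> V" "x \<in> carrier G"
  shows "V #> (v \<otimes> x) = V #> x"
  using assms by (simp add: rcos_eq_iff subgroup.mem_carrier m_assoc)

text \<open>Dividing \<open>x\<close> on the right by a representative of its right coset lands in
  \<open>V\<close>; left multiplication by \<open>V\<close> leaves the representative unchanged, so
  the quotient is equivariant. Such a map carries means of \<open>G\<close> to means of
  \<open>V\<close>.\<close>

lemma subgroup_equivariant_retraction:
  assumes V: "subgroup V G"
  obtains \<rho> where "\<And>x. x \<in> carrier G \<Longrightarrow> \<rho> x \<in> V"
    "\<And>v x. v \<in> V \<Longrightarrow> x \<in> carrier G \<Longrightarrow> \<rho> (v \<otimes> x) = v \<otimes> \<rho> x"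
proof
  define r where "r = (\<lambda>x. SOME y. y \<in> V #> x)"
  have "r x \<in> V #> x" if "x \<in> carrier G" for x
    using rcos_self[OF that V] unfolding r_def by (rule someI)
  then have r: "r x \<in> carrier G" "V #> x = V #> r x" if "x \<in> carrier G" for x
    using that V repr_independence[of "r x" V x] r_coset_subset_G[of V x]
    by (auto simp: subgroup.subset)
  have r_eq: "r (v \<otimes> x) = r x" if "v \<in> V" "x \<in> carrier G" for v x
    using rcos_mult_left[OF V that] by (simp add: r_def)
  show "x \<otimes> inv (r x) \<in> V" if "x \<in> carrier G" for x
    using r[OF that] that rcos_eq_iff[OF V] by blast
  show "(v \<otimes> x) \<otimes> inv (r (v \<otimes> x)) = v \<otimes> (x \<otimes> inv (r x))" if "v \<in> V" "x \<in> carrier G" for v x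
    using that r(1)[OF that(2)] subgroup.mem_carrier[OF V that(1)] by (simp add: r_eq m_assoc)
qed

text \<open>An equivariant bijection sends right cosets of \<open>V\<close> to right cosets. The
  kernel \<open>K\<close> of this action has finite index because there are finitely many cosets, so
  amenability of \<open>K\<close> is enough. An element of \<open>K\<close> is a choice of a right
  factor in \<open>V\<close> for each coset, and the retraction to \<open>V\<close>, applied in each
  coordinate, gives an equivariant map from a finite power of \<open>G\<close> to
  \<open>K\<close>.\<close>

lemma amenable_left_equivariant:
  assumes am: "amenable G" and normal: "V \<lhd> G" and fin: "finite (rcosets V)"
  shows "amenable (BijGroup (carrier G)\<lparr>carrier := left_equivariant G V\<rparr>)"
proof -
  interpret V: normal V G by (fact normal)
  have V: "subgroup V G"
    by (rule V.subgroup_axioms)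
  let ?B = "BijGroup (carrier G)"
  let ?L = "left_equivariant G V"
  let ?H = "?B\<lparr>carrier := ?L\<rparr>"
  define K where "K = {f \<in> ?L. \<forall>x \<in> carrier G. V #> f x = V #> x}"
  have L: "subgroup ?L ?B"
    by (rule subgroup_left_equivariant) (rule V.subset)
  have H: "group ?H"
    by (rule subgroup.subgroup_is_group[OF L group_BijGroup])
  have L_Bij: "f \<in> Bij (carrier G)" if "f \<in> ?L" for f
    using that by (simp add: left_equivariant_def)
  have L_eq: "f (v \<otimes> x) = v \<otimes> f x" if "f \<in> ?L" "v \<in> V" "x \<in> carrier G" for f v x
    using that by (simp add: left_equivariant_def)
  have K: "subgroup K ?B"
  proof (rule group.subgroupI[OF group_BijGroup])
    show "K \<subseteq> carrier ?B"
      using subgroup.subset[OF L] by (auto simp: K_def)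
    show "K \<noteq> {}"
      using subgroup.one_closed[OF L] by (auto simp: K_def BijGroup_simps)
  next
    fix f assume f: "f \<in> K"
    have "V #> (inv\<^bsub>?B\<^esub> f) x = V #> x" if "x \<in> carrier G" for x
      using f that Bij_inverse[OF L_Bij, of f x] unfolding K_def by fastforce
    then show "inv\<^bsub>?B\<^esub> f \<in> K"
      using f subgroup.m_inv_closed[OF L] by (simp add: K_def)
  next
    fix f g assume "f \<in> K" "g \<in> K"
    then show "f \<otimes>\<^bsub>?B\<^esub> g \<in> K"
      using subgroup.m_closed[OF L]
      by (auto simp: K_def BijGroup_simps L_Bij compose_eq Bij_mem)
  qed
  have KH: "subgroup K ?H"
    by (rule group.subgroup_incl[OF group_BijGroup K L]) (auto simp: K_def)
  have "finite (rcosets\<^bsub>?H\<^esub> K)"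
  proof -
    \<comment> \<open>The permutation of the cosets induced by \<open>f\<close>, computed on chosen
      representatives. It is extensional, so its values range over a finite function space.\<close>
    define \<pi> where "\<pi> = (\<lambda>f. \<lambda>C \<in> rcosets V. V #> f (SOME c. c \<in> C))"
    have "\<pi> f \<in> (rcosets V) \<rightarrow>\<^sub>E (rcosets V)" if f: "f \<in> ?L" for f
    proof -
      have "V #> f (SOME c. c \<in> C) \<in> rcosets V" if C: "C \<in> rcosets V" for C
      proof -
        have "(SOME c. c \<in> C) \<in> C"
          using C rcos_self[OF _ V] by (auto simp: RCOSETS_def some_in_eq)
        then have "(SOME c. c \<in> C) \<in> carrier G"
          using rcosets_part_G[OF V] C by blast
        then show ?thesis
          using Bij_mem[OF L_Bij[OF f]] rcosetsI[OF V.subset] by blast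
      qed
      then show ?thesis
        by (auto simp: \<pi>_def)
    qed
    then have fin\<pi>: "finite (\<pi> ` ?L)"
      using fin by (auto intro: finite_subset[OF _ finite_PiE[of "rcosets V" "\<lambda>_. rcosets V"]])
    \<comment> \<open>Bijections inducing the same permutation differ by an element of
      \<open>K\<close>; thus \<open>\<pi>\<close> separates the cosets of \<open>K\<close>.\<close>
    have same: "K #>\<^bsub>?H\<^esub> f = K #>\<^bsub>?H\<^esub> g" if fg: "f \<in> ?L" "g \<in> ?L" "\<pi> f = \<pi> g" for f g
    proof -
      have eq: "V #> f x = V #> g x" if x: "x \<in> carrier G" for x
      proof -
        define c where "c = (SOME c. c \<in> V #> x)"
        have "c \<in> V #> x"
          unfolding c_def using rcos_self[OF x V] by (rule someI)
        then have c: "c \<in> carrier G" "V #> x = V #> c"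
          using x repr_independence[of c V x] r_coset_subset_G[of V x] V by (auto simp: V.subset)
        obtain v where v: "v \<in> V" "x = v \<otimes> c"
          using rcos_self[OF x V] c(2) by (auto simp: r_coset_def)
        have "V #> f c = V #> g c"
          using fun_cong[OF fg(3), of "V #> x"] rcosetsI[OF V.subset x] by (simp add: \<pi>_def c_def)
        then show ?thesis
          using v c(1) fg by (simp add: L_eq rcos_mult_left[OF V] Bij_mem[OF L_Bij])
      qed
      let ?k = "f \<otimes>\<^bsub>?B\<^esub> inv\<^bsub>?B\<^esub> g"
      have gB: "inv\<^bsub>?B\<^esub> g \<in> ?L"
        using subgroup.m_inv_closed[OF L fg(2)] .
      have "V #> ?k x = V #> x" if "x \<in> carrier G" for x
        using that eq[of "(inv\<^bsub>?B\<^esub> g) x"] fg gB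
        by (simp add: BijGroup_simps L_Bij compose_eq Bij_inverse)
      then have "?k \<in> K"
        using subgroup.m_closed[OF L fg(1) gB] by (simp add: K_def)
      then have "f \<otimes>\<^bsub>?H\<^esub> inv\<^bsub>?H\<^esub> g \<in> K"
        using group.m_inv_consistent[OF group_BijGroup L fg(2)] by simp
      then show ?thesis
        using group.rcos_eq_iff[OF H KH, of f g] fg by simp
    qed
    have "rcosets\<^bsub>?H\<^esub> K \<subseteq> (\<lambda>p. K #>\<^bsub>?H\<^esub> (SOME g. g \<in> ?L \<and> \<pi> g = p)) ` \<pi> ` ?L"
    proof
      fix D assume "D \<in> rcosets\<^bsub>?H\<^esub> K"
      then obtain f where f: "f \<in> ?L" "D = K #>\<^bsub>?H\<^esub> f"
        by (auto simp: RCOSETS_def)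
      define g where "g = (SOME g. g \<in> ?L \<and> \<pi> g = \<pi> f)"
      have "g \<in> ?L \<and> \<pi> g = \<pi> f"
        unfolding g_def by (rule someI[of _ f]) (simp add: f)
      then have "D = K #>\<^bsub>?H\<^esub> g"
        using same[of f g] f by simp
      then show "D \<in> (\<lambda>p. K #>\<^bsub>?H\<^esub> (SOME g. g \<in> ?L \<and> \<pi> g = p)) ` \<pi> ` ?L"
        using f(1) unfolding g_def by blast
    qed
    then show ?thesis
      using fin\<pi> finite_subset by blast
  qed
  then have index: "finite_index ?H K"
    using KH by (simp add: finite_index_def)
  have "amenable (?B\<lparr>carrier := K\<rparr>)"
  proof -
    let ?P = "product_group (rcosets V) (\<lambda>_. G)"
    obtain \<rho> where \<rho>: "\<And>x. x \<in> carrier G \<Longrightarrow> \<rho> x \<in> V"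
      and \<rho>_eq: "\<And>v x. v \<in> V \<Longrightarrow> x \<in> carrier G \<Longrightarrow> \<rho> (v \<otimes> x) = v \<otimes> \<rho> x"
      using subgroup_equivariant_retraction[OF V] by blast
    \<comment> \<open>The inverse is needed for the order of multiplication: a left factor in
      \<open>c\<close> must become the last right factor of \<open>r c x\<close>, which is the
      effect of composing with another element of \<open>K\<close> on the left.\<close>
    define r where "r = (\<lambda>c. \<lambda>x \<in> carrier G. x \<otimes> inv (\<rho> (c (V #> x))))"
    \<comment> \<open>Normality enters here. Since right factors from \<open>V\<close> do not change
      the coset, \<open>r c\<close> can be undone by reading the same coordinate of \<open>c\<close>
      again.\<close>
    have coset_r: "V #> (x \<otimes> v) = V #> x" if "v \<in> V" "x \<in> carrier G" for v x
      using that V.inv_op_closed2[of x v] by (simp add: rcos_eq_iff[OF V])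
    have coset_in: "V #> x \<in> rcosets V" if "x \<in> carrier G" for x
      using rcosetsI[OF V.subset that] .
    have r_K: "r c \<in> K" if c: "c \<in> carrier ?P" for c
    proof -
      have \<rho>V: "\<rho> (c (V #> x)) \<in> V" if "x \<in> carrier G" for x
        using c coset_in[OF that] by (intro \<rho>) auto
      then have \<rho>G: "\<rho> (c (V #> x)) \<in> carrier G" if "x \<in> carrier G" for x
        using that V.mem_carrier by blast
      have "r c \<in> Bij (carrier G)"
        by (rule BijI[where g = "\<lambda>x. x \<otimes> \<rho> (c (V #> x))"])
          (simp_all add: r_def \<rho>V \<rho>G coset_r m_assoc)
      moreover have "r c (v \<otimes> x) = v \<otimes> r c x" if "v \<in> V" "x \<in> carrier G" for v x
        using that \<rho>G[OF that(2)] by (simp add: r_def rcos_mult_left[OF V] m_assoc)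
      moreover have "V #> r c x = V #> x" if "x \<in> carrier G" for x
        using that by (simp add: r_def coset_r \<rho>V)
      ultimately show ?thesis
        by (simp add: K_def left_equivariant_def)
    qed
    have "amenable ?P"
      by (rule amenable_finite_product[OF fin am])
    then show ?thesis
    proof (rule amenable_transfer[where r = r])
      show "group (?B\<lparr>carrier := K\<rparr>)"
        by (rule subgroup.subgroup_is_group[OF K group_BijGroup])
      show "r c \<in> carrier (?B\<lparr>carrier := K\<rparr>)" if "c \<in> carrier ?P" for c
        using r_K[OF that] by simp
    next
      fix h assume "h \<in> carrier (?B\<lparr>carrier := K\<rparr>)"
      then have hK: "h \<in> K"
        by simp
      then have h: "h \<in> ?L"
        by (simp add: K_def)
      have hG: "h x \<in> carrier G" if "x \<in> carrier G" for x
        using Bij_mem[OF L_Bij[OF h] that] .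
      \<comment> \<open>The coordinates of \<open>h\<close>: by equivariance
        \<open>inv (h x) \<otimes> x\<close> is constant on each coset, so a representative computes
        it, and \<open>h x = x \<otimes> inv (d (V #> x))\<close>.\<close>
      define d where "d = (\<lambda>C \<in> rcosets V. inv (h (SOME c. c \<in> C)) \<otimes> (SOME c. c \<in> C))"
      have d: "d (V #> x) = inv (h x) \<otimes> x" "d (V #> x) \<in> V" if x: "x \<in> carrier G" for x
      proof -
        define c where "c = (SOME c. c \<in> V #> x)"
        have "c \<in> V #> x"
          unfolding c_def using rcos_self[OF x V] by (rule someI)
        then obtain v where v: "v \<in> V" "c = v \<otimes> x"
          by (auto simp: r_coset_def)
        have "d (V #> x) = inv (h (v \<otimes> x)) \<otimes> (v \<otimes> x)"
          using coset_in[OF x] v(2) by (simp add: d_def c_def)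
        also have "\<dots> = inv (h x) \<otimes> x"
          using v(1) x hG[OF x] by (simp add: L_eq[OF h] inv_mult_group m_assoc inv_solve_left)
            (simp add: m_assoc[symmetric])
        finally show d_eq: "d (V #> x) = inv (h x) \<otimes> x" .
        have "V #> x = V #> h x"
          using hK x by (simp add: K_def)
        then have "x \<otimes> inv (h x) \<in> V"
          using rcos_eq_iff[OF V x hG[OF x]] by simp
        \<comment> \<open>Equality of right cosets puts the quotient in \<open>V\<close> with the
          factors in the wrong order; conjugation by \<open>h x\<close> exchanges them.\<close>
        then have "inv (h x) \<otimes> (x \<otimes> inv (h x)) \<otimes> h x \<in> V"
          using V.inv_op_closed1[OF hG[OF x]] by blast
        then show "d (V #> x) \<in> V"
          using x hG[OF x] by (simp add: d_eq m_assoc)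
      qed
      have dP: "d \<in> carrier ?P"
      proof -
        have "d C \<in> carrier G" if "C \<in> rcosets V" for C
          using that d(2) V.mem_carrier by (auto simp: RCOSETS_def)
        then show ?thesis
          by (auto simp: d_def)
      qed
      show "\<exists>g\<in>carrier ?P. \<forall>c\<in>carrier ?P. r (g \<otimes>\<^bsub>?P\<^esub> c) = h \<otimes>\<^bsub>?B\<lparr>carrier := K\<rparr>\<^esub> r c"
      proof (intro bexI[OF _ dP] ballI)
        fix c assume c: "c \<in> carrier ?P"
        have dc: "d \<otimes>\<^bsub>?P\<^esub> c \<in> carrier ?P"
          using dP c by (intro monoid.m_closed[OF group.is_monoid] product_group) (auto intro: is_group)
        have rc: "r c \<in> K" "r (d \<otimes>\<^bsub>?P\<^esub> c) \<in> K"
          using r_K c dc by blast+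
        have "r (d \<otimes>\<^bsub>?P\<^esub> c) = compose (carrier G) h (r c)"
        proof (rule Bij_ext)
          show "r (d \<otimes>\<^bsub>?P\<^esub> c) \<in> Bij (carrier G)"
            using rc L_Bij by (simp add: K_def)
          show "compose (carrier G) h (r c) \<in> Bij (carrier G)"
            using rc h L_Bij by (auto simp: K_def intro: compose_Bij)
          fix x assume x: "x \<in> carrier G"
          let ?u = "\<rho> (c (V #> x))"
          have cG: "c (V #> x) \<in> carrier G"
            using c coset_in[OF x] by auto
          have u: "?u \<in> V" "?u \<in> carrier G"
            using \<rho>[OF cG] V.mem_carrier by blast+
          let ?y = "x \<otimes> inv ?u"
          have y: "?y \<in> carrier G"
            using x u by simp
          have "r (d \<otimes>\<^bsub>?P\<^esub> c) x = x \<otimes> inv (d (V #> x) \<otimes> ?u)"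
            using x coset_in[OF x] cG d(2)[OF x] by (simp add: r_def \<rho>_eq)
          also have "\<dots> = ?y \<otimes> inv (d (V #> x))"
            using x u d(2)[OF x] by (simp add: inv_mult_group m_assoc)
          \<comment> \<open>\<open>?y\<close> lies in the coset of \<open>x\<close>, so the
            coordinate of \<open>d\<close> there may be computed from \<open>h ?y\<close>, which is
            what the composition needs.\<close>
          also have "d (V #> x) = inv (h ?y) \<otimes> ?y"
            using d(1)[OF y] coset_r[of "inv ?u" x] x u by simp
          also have "?y \<otimes> inv (inv (h ?y) \<otimes> ?y) = h ?y"
            using y hG[OF y] by (simp add: inv_mult_group m_assoc[symmetric])
          finally show "r (d \<otimes>\<^bsub>?P\<^esub> c) x = compose (carrier G) h (r c) x"
            using x by (simp add: compose_eq r_def)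
        qed
        then show "r (d \<otimes>\<^bsub>?P\<^esub> c) = h \<otimes>\<^bsub>?B\<lparr>carrier := K\<rparr>\<^esub> r c"
          using h rc by (simp add: BijGroup_simps K_def L_Bij)
      qed
    qed
  qed
  then show ?thesis
    using amenable_finite_index_overgroup[OF H index] by simp
qed

lemma subgroup_increasing_union:
  assumes sub: "\<And>n. subgroup (H n) G" and mono: "\<And>n. H n \<subseteq> H (Suc n)"
  shows "subgroup (\<Union>n::nat. H n) G"
proof (rule subgroupI)
  show "(\<Union>n. H n) \<subseteq> carrier G" "(\<Union>n. H n) \<noteq> {}"
    using subgroup.subset[OF sub] subgroup.one_closed[OF sub] by blast+
  show "inv a \<in> (\<Union>n. H n)" if "a \<in> (\<Union>n. H n)" for a
    using that subgroup.m_inv_closed[OF sub] by blast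
next
  fix a b assume "a \<in> (\<Union>n. H n)" "b \<in> (\<Union>n. H n)"
  then obtain i j where "a \<in> H i" "b \<in> H j"
    by blast
  then have "a \<in> H (max i j)" "b \<in> H (max i j)"
    using lift_Suc_mono_le[of H, OF mono] by (meson max.cobounded1 max.cobounded2 subsetD)+
  then show "a \<otimes> b \<in> (\<Union>n. H n)"
    using subgroup.m_closed[OF sub] by blast
qed

end

section \<open>Locally equivariant bijections along a decreasing sequence of normal subgroups of
  finite index\<close>

locale normal_filtration = group X for X :: "('a, 'b) monoid_scheme" (structure) +
  fixes U :: "nat \<Rightarrow> 'a set"
  assumes U_normal: "\<And>n. U n \<lhd> X" and U_finite: "\<And>n. finite (rcosets (U n))"
    and U_decreasing: "\<And>n. U (Suc n) \<subseteq> U n"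
begin

abbreviation "left_locally \<equiv> BijGroup (carrier X)\<lparr>carrier := (\<Union>n. left_equivariant X (U n))\<rparr>"
abbreviation "right_locally \<equiv> BijGroup (carrier X)\<lparr>carrier := (\<Union>n. right_equivariant X (U n))\<rparr>"

lemma U_subset: "U n \<subseteq> carrier X"
  using U_normal[of n] by (simp add: normal_def subgroup.subset)

lemma left_increasing: "left_equivariant X (U n) \<subseteq> left_equivariant X (U (Suc n))"
  using U_decreasing[of n] by (auto simp: left_equivariant_def)

lemma right_increasing: "right_equivariant X (U n) \<subseteq> right_equivariant X (U (Suc n))"
  using U_decreasing[of n] by (auto simp: right_equivariant_def)

lemma subgroup_left_locally: "subgroup (\<Union>n. left_equivariant X (U n)) (BijGroup (carrier X))"
  by (intro group.subgroup_increasing_union group_BijGroup subgroup_left_equivariant U_subset left_increasing)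

lemma subgroup_right_locally: "subgroup (\<Union>n. right_equivariant X (U n)) (BijGroup (carrier X))"
  by (intro group.subgroup_increasing_union group_BijGroup subgroup_right_equivariant U_subset right_increasing)

lemma group_left_locally: "group left_locally"
  by (rule subgroup.subgroup_is_group[OF subgroup_left_locally group_BijGroup])

lemma group_right_locally: "group right_locally"
  by (rule subgroup.subgroup_is_group[OF subgroup_right_locally group_BijGroup])

lemma amenable_left_locally:
  assumes "amenable X"
  shows "amenable left_locally"
proof (rule amenable_increasing_union[OF group_left_locally])
  fix n
  show "subgroup (left_equivariant X (U n)) left_locally"
    by (rule group.subgroup_incl[OF group_BijGroup subgroup_left_equivariant[OF U_subset] subgroup_left_locally]) blast
  show "amenable (left_locally\<lparr>carrier := left_equivariant X (U n)\<rparr>)"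
    using amenable_left_equivariant[OF assms U_normal U_finite, of n] by simp
qed (use left_increasing in auto)

text \<open>Composing \<open>f\<close> with right multiplication by \<open>inv h\<close> turns
  \<open>f \<one>\<close> into \<open>f \<one> \<otimes> inv h\<close>, and inversion makes this a
  left multiplication by \<open>h\<close>. So evaluation at the identity followed by inversion is
  equivariant.\<close>

lemma amenable_of_left_locally:
  assumes "amenable left_locally"
  shows "amenable X"
proof (rule amenable_transfer[OF assms is_group, where r = "\<lambda>f. inv (f \<one>)"])
  have mem: "f \<in> Bij (carrier X)" if "f \<in> carrier left_locally" for f
    using that by (auto simp: left_equivariant_def)
  then show "inv (f \<one>) \<in> carrier X" if "f \<in> carrier left_locally" for f
    using Bij_mem[OF mem[OF that]] by simp
  fix h assume h: "h \<in> carrier X"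
  \<comment> \<open>Right translations commute with every left multiplication, so they already lie
    in stage 0 of the union.\<close>
  let ?g = "\<lambda>x \<in> carrier X. x \<otimes> inv h"
  have "?g \<in> Bij (carrier X)"
    by (rule BijI[where g = "\<lambda>x. x \<otimes> h"]) (simp_all add: h m_assoc)
  then have g: "?g \<in> left_equivariant X (U 0)"
    using h U_subset[of 0] by (auto simp: left_equivariant_def m_assoc)
  show "\<exists>g\<in>carrier left_locally. \<forall>f\<in>carrier left_locally.
      inv ((g \<otimes>\<^bsub>left_locally\<^esub> f) \<one>) = h \<otimes> inv (f \<one>)"
  proof (intro bexI ballI)
    show g': "?g \<in> carrier left_locally"
      using g by auto
    fix f assume "f \<in> carrier left_locally"
    then show "inv ((?g \<otimes>\<^bsub>left_locally\<^esub> f) \<one>) = h \<otimes> inv (f \<one>)"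
      using h mem[OF g'] mem[of f] Bij_mem[OF mem, of f \<one>]
      by (simp add: BijGroup_simps compose_eq inv_mult_group)
  qed
qed

text \<open>Conjugation by inversion exchanges the two groups.\<close>

definition "inverted f = (\<lambda>x \<in> carrier X. inv (f (inv x)))"

lemma inverted_Bij:
  assumes "f \<in> Bij (carrier X)"
  shows "inverted f \<in> Bij (carrier X)"
  by (rule BijI[where g = "\<lambda>x. inv ((inv\<^bsub>BijGroup (carrier X)\<^esub> f) (inv x))"])
    (simp_all add: inverted_def Bij_mem[OF assms] Bij_inverse[OF assms])

lemma inverted_left:
  assumes f: "f \<in> left_equivariant X (U n)"
  shows "inverted f \<in> right_equivariant X (U n)"
proof -
  have B: "f \<in> Bij (carrier X)"
    using f by (simp add: left_equivariant_def)
  have "inverted f (x \<otimes> u) = inverted f x \<otimes> u" if "u \<in> U n" "x \<in> carrier X" for u x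
  proof -
    have u: "u \<in> carrier X" "inv u \<in> U n"
      using that U_normal[of n] U_subset[of n] by (auto simp: normal_def subgroup.m_inv_closed)
    then have "f (inv u \<otimes> inv x) = inv u \<otimes> f (inv x)"
      using f that by (simp add: left_equivariant_def)
    then show ?thesis
      using that u Bij_mem[OF B] by (simp add: inverted_def inv_mult_group)
  qed
  then show ?thesis
    using inverted_Bij[OF B] by (simp add: right_equivariant_def)
qed

lemma inverted_right:
  assumes f: "f \<in> right_equivariant X (U n)"
  shows "inverted f \<in> left_equivariant X (U n)"
proof -
  have B: "f \<in> Bij (carrier X)"
    using f by (simp add: right_equivariant_def)
  have "inverted f (u \<otimes> x) = u \<otimes> inverted f x" if "u \<in> U n" "x \<in> carrier X" for u x
  proof -
    have u: "u \<in> carrier X" "inv u \<in> U n"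
      using that U_normal[of n] U_subset[of n] by (auto simp: normal_def subgroup.m_inv_closed)
    then have "f (inv x \<otimes> inv u) = f (inv x) \<otimes> inv u"
      using f that by (simp add: right_equivariant_def)
    then show ?thesis
      using that u Bij_mem[OF B] by (simp add: inverted_def inv_mult_group)
  qed
  then show ?thesis
    using inverted_Bij[OF B] by (simp add: left_equivariant_def)
qed

lemma inverted_inverted: "f \<in> Bij (carrier X) \<Longrightarrow> inverted (inverted f) = f"
  by (rule Bij_ext) (simp_all add: inverted_Bij, simp add: inverted_def Bij_mem)

lemma inverted_compose:
  "f \<in> Bij (carrier X) \<Longrightarrow> g \<in> Bij (carrier X) \<Longrightarrow>
    inverted (compose (carrier X) f g) = compose (carrier X) (inverted f) (inverted g)"
  by (auto simp: inverted_def compose_def fun_eq_iff Bij_mem)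

text \<open>\<open>inverted\<close> is multiplicative and its own inverse, so a translation by
  \<open>h\<close> lifts to the translation by \<open>inverted h\<close>, in either
  direction.\<close>

lemma amenable_right_locally_iff: "amenable right_locally \<longleftrightarrow> amenable left_locally"
proof
  have L: "f \<in> Bij (carrier X)" if "f \<in> carrier left_locally" for f
    using that by (auto simp: left_equivariant_def)
  have R: "f \<in> Bij (carrier X)" if "f \<in> carrier right_locally" for f
    using that by (auto simp: right_equivariant_def)
  show "amenable left_locally" if "amenable right_locally"
  proof (rule amenable_transfer[OF that group_left_locally, where r = inverted])
    fix h assume h: "h \<in> carrier left_locally"
    show "\<exists>g\<in>carrier right_locally. \<forall>f\<in>carrier right_locally.
        inverted (g \<otimes>\<^bsub>right_locally\<^esub> f) = h \<otimes>\<^bsub>left_locally\<^esub> inverted f"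
    proof (intro bexI[of _ "inverted h"] ballI)
      fix f assume "f \<in> carrier right_locally"
      then show "inverted (inverted h \<otimes>\<^bsub>right_locally\<^esub> f) = h \<otimes>\<^bsub>left_locally\<^esub> inverted f"
        using L[OF h] R[of f] by (simp add: BijGroup_simps inverted_Bij inverted_compose inverted_inverted)
    qed (use h inverted_left in auto)
  qed (use inverted_right in auto)
  show "amenable right_locally" if "amenable left_locally"
  proof (rule amenable_transfer[OF that group_right_locally, where r = inverted])
    fix h assume h: "h \<in> carrier right_locally"
    show "\<exists>g\<in>carrier left_locally. \<forall>f\<in>carrier left_locally.
        inverted (g \<otimes>\<^bsub>left_locally\<^esub> f) = h \<otimes>\<^bsub>right_locally\<^esub> inverted f"
    proof (intro bexI[of _ "inverted h"] ballI)
      fix f assume "f \<in> carrier left_locally"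
      then show "inverted (inverted h \<otimes>\<^bsub>left_locally\<^esub> f) = h \<otimes>\<^bsub>right_locally\<^esub> inverted f"
        using R[OF h] L[of f] by (simp add: BijGroup_simps inverted_Bij inverted_compose inverted_inverted)
    qed (use h inverted_right in auto)
  qed (use inverted_left in auto)
qed

end

section \<open>The odometer as a profinite group\<close>

locale free_odometer = group G for G :: "('a, 'b) monoid_scheme" (structure) +
  fixes \<Gamma> :: "nat \<Rightarrow> 'a set"
  assumes scale: "subgroup_scale G \<Gamma>"
begin

abbreviation "Z \<equiv> odometer G \<Gamma>"
abbreviation "T \<equiv> odometer_topology G \<Gamma>"
abbreviation "\<tau> \<equiv> odometer_embedding G \<Gamma>"

definition Q :: "nat \<Rightarrow> 'a set monoid"
  where "Q n = G Mod \<Gamma> n"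

definition U :: "nat \<Rightarrow> (nat \<Rightarrow> 'a set) set"
  where "U n = {u \<in> carrier Z. u n = \<Gamma> n}"

lemma \<Gamma>_normal: "\<Gamma> n \<lhd> G" and \<Gamma>_finite: "finite (rcosets (\<Gamma> n))"
  and \<Gamma>_Suc: "\<Gamma> (Suc n) \<subseteq> \<Gamma> n" and \<Gamma>_index: "finite_index G (\<Gamma> n)"
  using scale by (auto simp: subgroup_scale_def finite_index_def)

lemma \<Gamma>_subgroup: "subgroup (\<Gamma> n) G"
  using \<Gamma>_normal[of n] by (simp add: normal_def)

lemma \<Gamma>_anti: "m \<le> n \<Longrightarrow> \<Gamma> n \<subseteq> \<Gamma> m"
  using lift_Suc_antimono_le[of \<Gamma>, OF \<Gamma>_Suc] .

lemma group_Q: "group (Q n)"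
  unfolding Q_def by (rule normal.factorgroup_is_group[OF \<Gamma>_normal])

lemma carrier_Q: "carrier (Q n) = rcosets (\<Gamma> n)"
  by (simp add: Q_def FactGroup_def)

lemma one_Q: "\<one>\<^bsub>Q n\<^esub> = \<Gamma> n"
  by (simp add: Q_def)

lemma \<tau>_in_Q: "g \<in> carrier G \<Longrightarrow> \<tau> g n \<in> carrier (Q n)"
  using rcosetsI[OF subgroup.subset[OF \<Gamma>_subgroup]] by (simp add: carrier_Q odometer_embedding_def)

lemma carrier_Z: "x \<in> carrier Z \<longleftrightarrow>
    (\<forall>n. x n \<in> carrier (Q n) \<and> coset_projection G (\<Gamma> n) (x (Suc n)) = x n)"
  by (auto simp: odometer_def Q_def)

lemma Z_coord: "x \<in> carrier Z \<Longrightarrow> x n \<in> carrier (Q n)"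
  by (simp add: carrier_Z)

lemma projection_\<tau>: "g \<in> carrier G \<Longrightarrow> coset_projection G (\<Gamma> n) (\<tau> g (Suc n)) = \<tau> g n"
  unfolding odometer_embedding_def
  by (rule coset_projection_rcos) (auto simp: is_group \<Gamma>_normal \<Gamma>_Suc)

lemma \<tau>_in_Z: "g \<in> carrier G \<Longrightarrow> \<tau> g \<in> carrier Z"
  by (simp add: carrier_Z \<tau>_in_Q projection_\<tau>)

lemma coord_eq_\<tau>:
  assumes "C \<in> carrier (Q n)"
  obtains g where "g \<in> carrier G" "C = \<tau> g n"
  using assms by (auto simp: carrier_Q RCOSETS_def odometer_embedding_def)

text \<open>Coherence propagates agreement downwards. One coordinate at a high level thus controls a
  whole initial segment, and finitely many conditions can be met at their maximal level.\<close>

lemma coord_determined: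
  assumes "x \<in> carrier Z" "y \<in> carrier Z" "x n = y n" "k \<le> n"
  shows "x k = y k"
  using \<open>k \<le> n\<close>
proof (induction k rule: inc_induct)
  case (step k)
  then show ?case
    using assms(1,2) by (metis carrier_Z)
qed (fact assms(3))

lemma mult_\<tau>: "g \<in> carrier G \<Longrightarrow> h \<in> carrier G \<Longrightarrow> \<tau> g n \<otimes>\<^bsub>Q n\<^esub> \<tau> h n = \<tau> (g \<otimes> h) n"
  by (simp add: Q_def odometer_embedding_def normal.rcos_sum[OF \<Gamma>_normal])

lemma inv_\<tau>: "g \<in> carrier G \<Longrightarrow> inv\<^bsub>Q n\<^esub> (\<tau> g n) = \<tau> (inv g) n"
proof (rule group.inv_equality[OF group_Q])
  assume g: "g \<in> carrier G"
  show "\<tau> (inv g) n \<otimes>\<^bsub>Q n\<^esub> \<tau> g n = \<one>\<^bsub>Q n\<^esub>"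
    using g coset_mult_one[OF subgroup.subset[OF \<Gamma>_subgroup[of n]]] by (simp add: mult_\<tau> one_Q)
      (simp add: odometer_embedding_def)
qed (simp_all add: \<tau>_in_Q)

text \<open>Every coset is a value of \<open>\<tau>\<close>, which is multiplicative at both levels
  and compatible with the projection.\<close>

lemma projection_mult:
  assumes "C \<in> carrier (Q (Suc n))" "D \<in> carrier (Q (Suc n))"
  shows "coset_projection G (\<Gamma> n) (C \<otimes>\<^bsub>Q (Suc n)\<^esub> D) =
      coset_projection G (\<Gamma> n) C \<otimes>\<^bsub>Q n\<^esub> coset_projection G (\<Gamma> n) D"
proof -
  obtain g h where "g \<in> carrier G" "C = \<tau> g (Suc n)" "h \<in> carrier G" "D = \<tau> h (Suc n)"
    using assms coord_eq_\<tau> by metis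
  then show ?thesis
    by (simp add: mult_\<tau> projection_\<tau>)
qed

lemma projection_inv:
  assumes "C \<in> carrier (Q (Suc n))"
  shows "coset_projection G (\<Gamma> n) (inv\<^bsub>Q (Suc n)\<^esub> C) = inv\<^bsub>Q n\<^esub> (coset_projection G (\<Gamma> n) C)"
proof -
  obtain g where "g \<in> carrier G" "C = \<tau> g (Suc n)"
    using assms coord_eq_\<tau> by metis
  then show ?thesis
    by (simp add: inv_\<tau> projection_\<tau>)
qed

lemma Z_eq: "Z = product_group UNIV Q \<lparr>carrier := carrier Z\<rparr>"
  by (simp add: odometer_def Q_def[abs_def])

lemma one_in_Z: "(\<lambda>n. \<one>\<^bsub>Q n\<^esub>) \<in> carrier Z"
proof -
  have "(\<lambda>n. \<one>\<^bsub>Q n\<^esub>) = \<tau> \<one>"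
    using coset_mult_one[OF subgroup.subset[OF \<Gamma>_subgroup]]
    by (auto simp: one_Q odometer_embedding_def)
  then show ?thesis
    using \<tau>_in_Z[of \<one>] by simp
qed

lemma subgroup_Z: "subgroup (carrier Z) (product_group UNIV Q)"
proof (rule group.subgroupI)
  show P: "group (product_group UNIV Q)"
    by (rule product_group) (rule group_Q)
  show sub: "carrier Z \<subseteq> carrier (product_group UNIV Q)"
    by (auto simp: Z_coord)
  show "carrier Z \<noteq> {}"
    using one_in_Z by blast
  fix x assume x: "x \<in> carrier Z"
  have "inv\<^bsub>product_group UNIV Q\<^esub> x = (\<lambda>n. inv\<^bsub>Q n\<^esub> (x n))"
    using x by (subst inv_product_group) (auto simp: Z_coord group_Q)
  then show "inv\<^bsub>product_group UNIV Q\<^esub> x \<in> carrier Z"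
    using x by (auto simp: carrier_Z projection_inv group.inv_closed[OF group_Q])
next
  fix x y assume "x \<in> carrier Z" "y \<in> carrier Z"
  then show "x \<otimes>\<^bsub>product_group UNIV Q\<^esub> y \<in> carrier Z"
    by (auto simp: carrier_Z projection_mult group.subgroup_self[OF group_Q] subgroup.m_closed)
qed

lemma group_Z: "group Z"
  using subgroup.subgroup_is_group[OF subgroup_Z product_group[OF group_Q]] Z_eq by metis

lemma mult_coord: "(x \<otimes>\<^bsub>Z\<^esub> y) n = x n \<otimes>\<^bsub>Q n\<^esub> y n"
  by (simp add: odometer_def Q_def)

lemma one_coord: "\<one>\<^bsub>Z\<^esub> n = \<one>\<^bsub>Q n\<^esub>"
  by (simp add: odometer_def Q_def)

lemma hom_coord: "(\<lambda>x. x n) \<in> hom Z (Q n)"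
  by (auto simp: hom_def mult_coord Z_coord)

lemma group_hom_coord: "group_hom Z (Q n) (\<lambda>x. x n)"
  by (intro group_hom.intro group_hom_axioms.intro group_Z group_Q hom_coord)

lemma U_eq_kernel: "U n = kernel Z (Q n) (\<lambda>x. x n)"
  by (simp add: U_def kernel_def one_Q)

lemma U_normal: "U n \<lhd> Z"
  unfolding U_eq_kernel by (rule group_hom.normal_kernel[OF group_hom_coord])

lemma U_subgroup: "subgroup (U n) Z"
  using U_normal by (simp add: normal_def)

lemma U_decreasing: "U (Suc n) \<subseteq> U n"
proof
  fix u assume u: "u \<in> U (Suc n)"
  then have "u n = \<one>\<^bsub>Z\<^esub> n"
    using group.is_monoid[OF group_Z] one_coord[of "Suc n"] one_Q[of "Suc n"]
    by (intro coord_determined[of u "\<one>\<^bsub>Z\<^esub>" "Suc n" n]) (auto simp: U_def)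
  then show "u \<in> U n"
    using u by (simp add: U_def one_coord one_Q)
qed

text \<open>The dictionary between algebra and topology: cosets of \<open>U n\<close>, on either
  side, are the cylinders given by the coordinate \<open>n\<close>.\<close>

lemma divide_in_U:
  assumes "x \<in> carrier Z" "y \<in> carrier Z"
  shows "y \<otimes>\<^bsub>Z\<^esub> inv\<^bsub>Z\<^esub> x \<in> U n \<longleftrightarrow> y n = x n" "inv\<^bsub>Z\<^esub> x \<otimes>\<^bsub>Z\<^esub> y \<in> U n \<longleftrightarrow> y n = x n"
proof -
  interpret Z: group Z by (rule group_Z)
  interpret Qn: group "Q n" by (rule group_Q)
  have inv: "(inv\<^bsub>Z\<^esub> x) n = inv\<^bsub>Q n\<^esub> (x n)"
    by (rule group_hom.hom_inv[OF group_hom_coord assms(1)])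
  have "x n \<in> carrier (Q n)" "y n \<in> carrier (Q n)"
    using assms Z_coord by auto
  then have "y n \<otimes>\<^bsub>Q n\<^esub> inv\<^bsub>Q n\<^esub> (x n) = \<one>\<^bsub>Q n\<^esub> \<longleftrightarrow> y n = x n"
    "inv\<^bsub>Q n\<^esub> (x n) \<otimes>\<^bsub>Q n\<^esub> y n = \<one>\<^bsub>Q n\<^esub> \<longleftrightarrow> y n = x n"
    using Qn.inv_solve_right'[of "\<one>\<^bsub>Q n\<^esub>" "y n" "x n"] Qn.inv_solve_left'[of "\<one>\<^bsub>Q n\<^esub>" "x n" "y n"] by auto
  then show "y \<otimes>\<^bsub>Z\<^esub> inv\<^bsub>Z\<^esub> x \<in> U n \<longleftrightarrow> y n = x n" "inv\<^bsub>Z\<^esub> x \<otimes>\<^bsub>Z\<^esub> y \<in> U n \<longleftrightarrow> y n = x n"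
    using assms by (simp_all add: U_def mult_coord inv one_Q)
qed

lemma finite_rcosets_U: "finite (rcosets\<^bsub>Z\<^esub> (U n))"
proof -
  interpret Z: group Z by (rule group_Z)
  have "U n #>\<^bsub>Z\<^esub> x = {y \<in> carrier Z. y n = x n}" if x: "x \<in> carrier Z" for x
    using x divide_in_U(1)[OF x] subgroup.rcos_module[OF U_subgroup group_Z x]
      Z.r_coset_subset_G[OF subgroup.subset[OF U_subgroup] x] by blast
  then have "rcosets\<^bsub>Z\<^esub> (U n) \<subseteq> (\<lambda>C. {y \<in> carrier Z. y n = C}) ` carrier (Q n)"
    using Z_coord by (auto simp: RCOSETS_def)
  then show ?thesis
    using \<Gamma>_finite[of n] by (auto simp: carrier_Q intro: finite_subset)
qed

sublocale Z: normal_filtration Z U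
  by (intro normal_filtration.intro group_Z normal_filtration_axioms.intro
      U_normal finite_rcosets_U U_decreasing)

lemma mult_U_coord:
  assumes "x \<in> carrier Z" "u \<in> U n"
  shows "(u \<otimes>\<^bsub>Z\<^esub> x) n = x n" "(x \<otimes>\<^bsub>Z\<^esub> u) n = x n"
  using assms Z_coord[of x n] group_Q[of n] one_Q[of n, symmetric]
  by (simp_all add: mult_coord U_def group.is_monoid monoid.l_one monoid.r_one)

subsection \<open>Topology\<close>

lemma topspace_T [simp]: "topspace T = carrier Z"
  using Z_coord by (auto simp: odometer_topology_def Q_def)

lemma T_eq: "T = subtopology (product_topology (\<lambda>n. discrete_topology (carrier (Q n))) UNIV) (carrier Z)"
  by (simp add: odometer_topology_def Q_def)

lemma continuous_map_coord: "continuous_map T (discrete_topology (carrier (Q n))) (\<lambda>x. x n)"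
  unfolding T_eq by (intro continuous_map_from_subtopology continuous_map_product_projection) simp

lemma openin_cylinder: "openin T {y \<in> carrier Z. y n = C}"
proof (cases "C \<in> carrier (Q n)")
  case True
  then show ?thesis
    using openin_continuous_map_preimage[OF continuous_map_coord, of n "{C}"] by simp
next
  case False
  then have "{y \<in> carrier Z. y n = C} = {}"
    using Z_coord by auto
  then show ?thesis
    by (simp only: openin_empty)
qed

text \<open>A basic open set of the product constrains finitely many coordinates. By coherence the
  coordinate at an upper bound of their indices controls them all, so cylinders on a single
  coordinate form a base.\<close>

lemma openin_T_iff:
  "openin T A \<longleftrightarrow> A \<subseteq> carrier Z \<and> (\<forall>x \<in> A. \<exists>n. \<forall>y \<in> carrier Z. y n = x n \<longrightarrow> y \<in> A)"
proof (intro iffI conjI ballI)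
  assume A: "openin T A"
  then show "A \<subseteq> carrier Z"
    using openin_subset by fastforce
  fix x assume x: "x \<in> A"
  obtain W where W: "openin (product_topology (\<lambda>n. discrete_topology (carrier (Q n))) UNIV) W"
    and AW: "A = W \<inter> carrier Z"
    using A unfolding T_eq openin_subtopology by blast
  obtain V where V: "finite {i. V i \<noteq> carrier (Q i)}" "x \<in> Pi\<^sub>E UNIV V" "Pi\<^sub>E UNIV V \<subseteq> W"
    using W x AW unfolding openin_product_topology_alt by fastforce
  obtain n where n: "\<And>i. V i \<noteq> carrier (Q i) \<Longrightarrow> i \<le> n"
    using V(1) by (auto simp: finite_nat_set_iff_bounded_le)
  have "y \<in> A" if y: "y \<in> carrier Z" "y n = x n" for y
  proof -
    have "y i \<in> V i" for i
    proof (cases "V i = carrier (Q i)")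
      case False
      then have "y i = x i"
        using n y x AW coord_determined by blast
      then show ?thesis
        using V(2) by auto
    qed (use y Z_coord in simp)
    then show ?thesis
      using V(3) y AW by auto
  qed
  then show "\<exists>n. \<forall>y \<in> carrier Z. y n = x n \<longrightarrow> y \<in> A"
    by blast
next
  assume A: "A \<subseteq> carrier Z \<and> (\<forall>x \<in> A. \<exists>n. \<forall>y \<in> carrier Z. y n = x n \<longrightarrow> y \<in> A)"
  show "openin T A"
  proof (subst openin_subopen, intro ballI)
    fix x assume x: "x \<in> A"
    then obtain n where "\<forall>y \<in> carrier Z. y n = x n \<longrightarrow> y \<in> A"
      using A by blast
    then show "\<exists>W. openin T W \<and> x \<in> W \<and> W \<subseteq> A"
      using x A by (intro exI[of _ "{y \<in> carrier Z. y n = x n}"]) (auto simp: openin_cylinder)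
  qed
qed

lemma closedin_cylinder: "closedin T {y \<in> carrier Z. y n = C}"
  unfolding closedin_def by (auto simp: openin_T_iff)

lemma continuous_map_T_iff:
  assumes f: "\<And>x. x \<in> carrier Z \<Longrightarrow> f x \<in> carrier Z"
  shows "continuous_map T T f \<longleftrightarrow>
    (\<forall>x \<in> carrier Z. \<forall>m. \<exists>n. \<forall>y \<in> carrier Z. y n = x n \<longrightarrow> f y m = f x m)"
proof (intro iffI ballI allI)
  fix x m assume c: "continuous_map T T f" and x: "x \<in> carrier Z"
  have "openin T {y \<in> carrier Z. f y \<in> {z \<in> carrier Z. z m = f x m}}"
    using openin_continuous_map_preimage[OF c openin_cylinder] by simp
  then show "\<exists>n. \<forall>y \<in> carrier Z. y n = x n \<longrightarrow> f y m = f x m"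
    using x f unfolding openin_T_iff by auto
next
  assume *: "\<forall>x \<in> carrier Z. \<forall>m. \<exists>n. \<forall>y \<in> carrier Z. y n = x n \<longrightarrow> f y m = f x m"
  show "continuous_map T T f"
    unfolding continuous_map_def
  proof (intro conjI allI impI)
    fix W assume W: "openin T W"
    show "openin T {x \<in> topspace T. f x \<in> W}"
      unfolding openin_T_iff
    proof (intro conjI ballI)
      fix x assume x: "x \<in> {x \<in> topspace T. f x \<in> W}"
      then obtain m where m: "\<forall>z \<in> carrier Z. z m = f x m \<longrightarrow> z \<in> W"
        using W unfolding openin_T_iff by blast
      obtain n where "\<forall>y \<in> carrier Z. y n = x n \<longrightarrow> f y m = f x m"
        using * x by fastforce
      then show "\<exists>n. \<forall>y \<in> carrier Z. y n = x n \<longrightarrow> y \<in> {x \<in> topspace T. f x \<in> W}"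
        using m f by (intro exI[of _ n]) auto
    qed auto
  qed (use f in auto)
qed

text \<open>A product of finite discrete spaces is compact, and each coherence equation cuts out a
  closed set, as the equalizer of two continuous maps into a Hausdorff space.\<close>

lemma compact_space_T: "compact_space T"
proof -
  let ?P = "product_topology (\<lambda>n. discrete_topology (carrier (Q n))) UNIV"
  have P: "topspace ?P = PiE UNIV (\<lambda>n. carrier (Q n))"
    by simp
  have compact: "compact_space ?P"
    using \<Gamma>_finite by (simp add: compact_space_product_topology compact_space_discrete_topology carrier_Q)
  have "closedin ?P {x \<in> topspace ?P. coset_projection G (\<Gamma> n) (x (Suc n)) = x n}" for n
  proof (rule closedin_continuous_maps_eq[where Y = "discrete_topology (carrier (Q n))"])
    have "coset_projection G (\<Gamma> n) C \<in> carrier (Q n)" if "C \<in> carrier (Q (Suc n))" for C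
      using coord_eq_\<tau>[OF that] projection_\<tau> \<tau>_in_Q by metis
    then have "continuous_map (discrete_topology (carrier (Q (Suc n)))) (discrete_topology (carrier (Q n)))
        (coset_projection G (\<Gamma> n))"
      by auto
    then have "continuous_map ?P (discrete_topology (carrier (Q n)))
        (coset_projection G (\<Gamma> n) \<circ> (\<lambda>x. x (Suc n)))"
      by (rule continuous_map_compose[rotated]) (rule continuous_map_product_projection, simp)
    then show "continuous_map ?P (discrete_topology (carrier (Q n)))
        (\<lambda>x. coset_projection G (\<Gamma> n) (x (Suc n)))"
      by (simp add: o_def)
    show "continuous_map ?P (discrete_topology (carrier (Q n))) (\<lambda>x. x n)"
      by (rule continuous_map_product_projection) simp
  qed (simp add: Hausdorff_space_discrete_topology)
  then have "closedin ?P (\<Inter>n. {x \<in> topspace ?P. coset_projection G (\<Gamma> n) (x (Suc n)) = x n})"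
    by (intro closedin_INT) auto
  also have "(\<Inter>n. {x \<in> topspace ?P. coset_projection G (\<Gamma> n) (x (Suc n)) = x n}) = carrier Z"
    unfolding P by (auto simp: carrier_Z PiE_iff)
  finally show ?thesis
    unfolding T_eq by (intro compact_space_subtopology closedin_compact_space[OF compact])
qed

text \<open>The Lebesgue number lemma for cylinders: finitely many cylinders subordinate to the
  cover suffice, and \<open>n\<close> bounds their levels.\<close>

lemma uniform_level:
  assumes open_cover: "\<And>A. A \<in> \<A> \<Longrightarrow> openin T A" "\<Union>\<A> = carrier Z"
  obtains n where "\<And>x. x \<in> carrier Z \<Longrightarrow> \<exists>A \<in> \<A>. \<forall>y \<in> carrier Z. y n = x n \<longrightarrow> y \<in> A"
proof -
  let ?cyl = "\<lambda>n x. {y \<in> carrier Z. y n = x n}"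
  let ?\<C> = "{?cyl n x | n x. x \<in> carrier Z \<and> (\<exists>A \<in> \<A>. ?cyl n x \<subseteq> A)}"
  have "carrier Z \<subseteq> \<Union>?\<C>"
  proof
    fix x assume x: "x \<in> carrier Z"
    then obtain A where A: "A \<in> \<A>" "x \<in> A"
      using open_cover(2) by blast
    then obtain n where "\<forall>y \<in> carrier Z. y n = x n \<longrightarrow> y \<in> A"
      using open_cover(1)[OF A(1)] unfolding openin_T_iff by blast
    then have "?cyl n x \<in> ?\<C>"
      using x A(1) by blast
    then show "x \<in> \<Union>?\<C>"
      by (rule UnionI) (use x in simp)
  qed
  moreover have "openin T C" if "C \<in> ?\<C>" for C
    using that by (auto simp: openin_cylinder)
  ultimately obtain \<F> where \<F>: "finite \<F>" "\<F> \<subseteq> ?\<C>" "carrier Z \<subseteq> \<Union>\<F>"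
    using compact_space_T[unfolded compact_space_alt, rule_format, of ?\<C>] by auto
  have "\<forall>C \<in> \<F>. \<exists>n x. C = ?cyl n x \<and> x \<in> carrier Z \<and> (\<exists>A \<in> \<A>. ?cyl n x \<subseteq> A)"
    using \<F>(2) by blast
  then have "\<exists>N. \<forall>C \<in> \<F>. \<exists>x. C = ?cyl (N C) x \<and> x \<in> carrier Z \<and> (\<exists>A \<in> \<A>. ?cyl (N C) x \<subseteq> A)"
    by (rule bchoice)
  then obtain N where N: "\<forall>C \<in> \<F>. \<exists>x. C = ?cyl (N C) x \<and> x \<in> carrier Z \<and> (\<exists>A \<in> \<A>. ?cyl (N C) x \<subseteq> A)"
    by (elim exE)
  obtain n where n: "\<And>C. C \<in> \<F> \<Longrightarrow> N C \<le> n"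
    using finite_nat_set_iff_bounded_le[of "N ` \<F>"] \<F>(1) by auto
  show thesis
  proof (rule that[of n])
    fix x assume x: "x \<in> carrier Z"
    then obtain C where C: "C \<in> \<F>" "x \<in> C"
      using \<F>(3) by blast
    obtain c A where c: "C = ?cyl (N C) c" "A \<in> \<A>" "?cyl (N C) c \<subseteq> A"
      using bspec[OF N C(1)] by (elim exE conjE bexE) (rule that)
    have "y \<in> A" if "y \<in> carrier Z" "y n = x n" for y
    proof -
      have "y (N C) = x (N C)"
        using coord_determined[OF that(1) x that(2) n[OF C(1)]] .
      moreover have "x (N C) = c (N C)"
        using c(1) C(2) by blast
      ultimately show ?thesis
        using that(1) by (intro subsetD[OF c(3)]) simp
    qed
    then show "\<exists>A \<in> \<A>. \<forall>y \<in> carrier Z. y n = x n \<longrightarrow> y \<in> A"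
      using c(2) by blast
  qed
qed

section \<open>Equivariant bijections are homeomorphisms\<close>

lemma homeomorphisms_Bij:
  assumes "f \<in> homeomorphisms T"
  shows "f \<in> Bij (carrier Z)"
  using assms homeomorphic_map_openness_eq[of T T f]
  by (auto simp: homeomorphisms_def Bij_def bij_betw_def homeomorphic_eq_everything_map)

text \<open>Maps equivariant under some \<open>U n\<close> preserve agreement of coordinates from the level \<open>n\<close> on.\<close>

lemma homeomorphismI:
  assumes "f \<in> Bij (carrier Z)"
    and f: "\<And>m x y. n \<le> m \<Longrightarrow> x \<in> carrier Z \<Longrightarrow> y \<in> carrier Z \<Longrightarrow> y m = x m \<Longrightarrow> f y m = f x m"
    and g: "\<And>m x y. n \<le> m \<Longrightarrow> x \<in> carrier Z \<Longrightarrow> y \<in> carrier Z \<Longrightarrow> y m = x m \<Longrightarrow>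
      (inv\<^bsub>BijGroup (carrier Z)\<^esub> f) y m = (inv\<^bsub>BijGroup (carrier Z)\<^esub> f) x m"
  shows "f \<in> homeomorphisms T"
proof -
  have cont: "continuous_map T T h" if h: "\<And>x. x \<in> carrier Z \<Longrightarrow> h x \<in> carrier Z"
    "\<And>m x y. n \<le> m \<Longrightarrow> x \<in> carrier Z \<Longrightarrow> y \<in> carrier Z \<Longrightarrow> y m = x m \<Longrightarrow> h y m = h x m" for h
  proof (subst continuous_map_T_iff[OF h(1)], assumption, intro ballI allI)
    fix x m assume x: "x \<in> carrier Z"
    \<comment> \<open>The hypothesis speaks only of levels from \<open>n\<close> on. Agreement is
      therefore imposed at \<open>max n m\<close>, preserved there, and brought down to
      \<open>m\<close>.\<close>
    have "h y m = h x m" if y: "y \<in> carrier Z" "y (max n m) = x (max n m)" for y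
      using coord_determined[OF h(1)[OF y(1)] h(1)[OF x] h(2)[OF _ x y]] by simp
    then show "\<exists>n. \<forall>y \<in> carrier Z. y n = x n \<longrightarrow> h y m = h x m"
      by blast
  qed
  have "homeomorphic_maps T T f (inv\<^bsub>BijGroup (carrier Z)\<^esub> f)"
    unfolding homeomorphic_maps_def
  proof (intro conjI)
    show "continuous_map T T f"
      by (rule cont, rule Bij_mem[OF assms(1)], assumption, rule f)
    show "continuous_map T T (inv\<^bsub>BijGroup (carrier Z)\<^esub> f)"
      by (rule cont, rule Bij_inverse(1)[OF assms(1)], assumption, rule g)
  qed (simp_all add: Bij_inverse[OF assms(1)])
  then show ?thesis
    using assms(1) homeomorphic_map_maps by (auto simp: homeomorphisms_def dest: Bij_imp_extensional)
qed

text \<open>The quotient of \<open>y\<close> by \<open>x\<close> lies in \<open>U m\<close>, hence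
  in \<open>U n\<close>. It can be pulled out of \<open>f\<close> as a member of \<open>U n\<close>,
  and does not change the coordinate \<open>m\<close> as a member of \<open>U m\<close>.\<close>

lemma left_equivariant_coord:
  assumes f: "f \<in> left_equivariant Z (U n)" and "n \<le> m" "x \<in> carrier Z" "y \<in> carrier Z" "y m = x m"
  shows "f y m = f x m"
proof -
  let ?u = "y \<otimes>\<^bsub>Z\<^esub> inv\<^bsub>Z\<^esub> x"
  have u: "?u \<in> U m" "?u \<in> U n"
    using coord_determined[OF assms(4,3,5,2)] assms(3-5) by (simp_all add: divide_in_U)
  have "f y = f (?u \<otimes>\<^bsub>Z\<^esub> x)"
    using assms(3,4) by (simp add: Z.m_assoc)
  also have "\<dots> = ?u \<otimes>\<^bsub>Z\<^esub> f x"
    using f u(2) assms(3) by (simp add: left_equivariant_def)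
  finally show ?thesis
    using mult_U_coord(1)[OF _ u(1), of "f x"] f assms(3) Bij_mem[of f] by (simp add: left_equivariant_def)
qed

lemma right_equivariant_coord:
  assumes f: "f \<in> right_equivariant Z (U n)" and "n \<le> m" "x \<in> carrier Z" "y \<in> carrier Z" "y m = x m"
  shows "f y m = f x m"
proof -
  let ?u = "inv\<^bsub>Z\<^esub> x \<otimes>\<^bsub>Z\<^esub> y"
  have u: "?u \<in> U m" "?u \<in> U n"
    using coord_determined[OF assms(4,3,5,2)] assms(3-5) by (simp_all add: divide_in_U)
  have "f y = f (x \<otimes>\<^bsub>Z\<^esub> ?u)"
    using assms(3,4) by (simp add: Z.m_assoc[symmetric])
  also have "\<dots> = f x \<otimes>\<^bsub>Z\<^esub> ?u"
    using f u(2) assms(3) by (simp add: right_equivariant_def)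
  finally show ?thesis
    using mult_U_coord(2)[OF _ u(1), of "f x"] f assms(3) Bij_mem[of f] by (simp add: right_equivariant_def)
qed

lemma left_equivariant_homeomorphism:
  assumes "f \<in> left_equivariant Z (U n)"
  shows "f \<in> homeomorphisms T"
proof (rule homeomorphismI[where n = n])
  show "f \<in> Bij (carrier Z)"
    using assms by (simp add: left_equivariant_def)
  show "f y m = f x m" if "n \<le> m" "x \<in> carrier Z" "y \<in> carrier Z" "y m = x m" for m x y
    using left_equivariant_coord[OF assms that] .
  show "(inv\<^bsub>BijGroup (carrier Z)\<^esub> f) y m = (inv\<^bsub>BijGroup (carrier Z)\<^esub> f) x m"
    if "n \<le> m" "x \<in> carrier Z" "y \<in> carrier Z" "y m = x m" for m x y
    using left_equivariant_coord[OF subgroup.m_inv_closed[OF Z.subgroup_left_equivariant assms] that]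
      Z.U_subset by blast
qed

lemma right_equivariant_homeomorphism:
  assumes "f \<in> right_equivariant Z (U n)"
  shows "f \<in> homeomorphisms T"
proof (rule homeomorphismI[where n = n])
  show "f \<in> Bij (carrier Z)"
    using assms by (simp add: right_equivariant_def)
  show "f y m = f x m" if "n \<le> m" "x \<in> carrier Z" "y \<in> carrier Z" "y m = x m" for m x y
    using right_equivariant_coord[OF assms that] .
  show "(inv\<^bsub>BijGroup (carrier Z)\<^esub> f) y m = (inv\<^bsub>BijGroup (carrier Z)\<^esub> f) x m"
    if "n \<le> m" "x \<in> carrier Z" "y \<in> carrier Z" "y m = x m" for m x y
    using right_equivariant_coord[OF subgroup.m_inv_closed[OF Z.subgroup_right_equivariant assms] that]
      Z.U_subset by blast
qed

section \<open>The three groups of homeomorphisms\<close>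

text \<open>\<open>uniform_level\<close> refines a clopen partition to the cylinders of one level;
  conversely those cylinders form a finite clopen partition. This replaces arbitrary pieces by
  cosets of \<open>U n\<close>.\<close>

lemma topological_full_group_iff:
  "f \<in> carrier (topological_full_group T K \<alpha>) \<longleftrightarrow>
    f \<in> homeomorphisms T \<and>
    (\<exists>n. \<forall>x \<in> carrier Z. \<exists>k \<in> carrier K. \<forall>y \<in> carrier Z. y n = x n \<longrightarrow> f y = \<alpha> k y)"
proof (intro iffI conjI)
  assume "f \<in> carrier (topological_full_group T K \<alpha>)"
  then obtain \<A> g where f: "f \<in> homeomorphisms T" and part: "partition_on (carrier Z) \<A>"
    and A: "\<And>A. A \<in> \<A> \<Longrightarrow> openin T A \<and> g A \<in> carrier K \<and> (\<forall>y \<in> A. f y = \<alpha> (g A) y)"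
    by (fastforce simp: topological_full_group_def)
  show "f \<in> homeomorphisms T"
    by (fact f)
  obtain n where "\<And>x. x \<in> carrier Z \<Longrightarrow> \<exists>A \<in> \<A>. \<forall>y \<in> carrier Z. y n = x n \<longrightarrow> y \<in> A"
    using uniform_level[of \<A>] A part by (auto simp: partition_on_def)
  then show "\<exists>n. \<forall>x \<in> carrier Z. \<exists>k \<in> carrier K. \<forall>y \<in> carrier Z. y n = x n \<longrightarrow> f y = \<alpha> k y"
    using A by meson
next
  assume *: "f \<in> homeomorphisms T \<and>
    (\<exists>n. \<forall>x \<in> carrier Z. \<exists>k \<in> carrier K. \<forall>y \<in> carrier Z. y n = x n \<longrightarrow> f y = \<alpha> k y)"
  then obtain n where n: "\<And>x. x \<in> carrier Z \<Longrightarrow> \<exists>k \<in> carrier K. \<forall>y \<in> carrier Z. y n = x n \<longrightarrow> f y = \<alpha> k y"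
    by blast
  let ?\<A> = "(\<lambda>x. {y \<in> carrier Z. y n = x n}) ` carrier Z"
  have "?\<A> \<subseteq> (\<lambda>C. {y \<in> carrier Z. y n = C}) ` carrier (Q n)"
    using Z_coord by auto
  then have fin: "finite ?\<A>"
    by (rule finite_subset) (simp add: carrier_Q \<Gamma>_finite)
  have part: "partition_on (carrier Z) ?\<A>"
    by (rule partition_onI) (auto simp: disjnt_def)
  have "\<forall>A \<in> ?\<A>. \<exists>k. k \<in> carrier K \<and> (\<forall>y \<in> A. f y = \<alpha> k y)"
    using n by fastforce
  then have "\<exists>g. \<forall>A \<in> ?\<A>. g A \<in> carrier K \<and> (\<forall>y \<in> A. f y = \<alpha> (g A) y)"
    by (rule bchoice)
  then obtain g where "\<forall>A \<in> ?\<A>. g A \<in> carrier K \<and> (\<forall>y \<in> A. f y = \<alpha> (g A) y)"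
    by (rule exE)
  then have "\<forall>A \<in> ?\<A>. openin T A \<and> closedin T A \<and> g A \<in> carrier K \<and> (\<forall>y \<in> A. f y = \<alpha> (g A) y)"
    using openin_cylinder closedin_cylinder by auto
  then have "\<exists>\<A> g. finite \<A> \<and> partition_on (topspace T) \<A> \<and>
      (\<forall>A \<in> \<A>. openin T A \<and> closedin T A \<and> g A \<in> carrier K \<and> (\<forall>y \<in> A. f y = \<alpha> (g A) y))"
    using fin part by (intro exI[of _ ?\<A>] exI[of _ g]) simp
  then show "f \<in> carrier (topological_full_group T K \<alpha>)"
    using * by (simp add: topological_full_group_def)
qed

text \<open>\<open>x\<close> and its product with \<open>u\<close> from \<open>U n\<close> on the
  left lie in one cylinder, so the same right factor applies to both and associativity gives
  equivariance. In the other direction equivariance fixes the right factor on each cylinder.\<close>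

lemma full_group_right_translation: "topological_full_group T Z (right_translation Z) = Z.left_locally"
proof -
  have "f \<in> carrier (topological_full_group T Z (right_translation Z)) \<longleftrightarrow>
    (\<exists>n. f \<in> left_equivariant Z (U n))" for f
  proof
    assume "f \<in> carrier (topological_full_group T Z (right_translation Z))"
    then obtain n where f: "f \<in> homeomorphisms T" and
      n: "\<And>x. x \<in> carrier Z \<Longrightarrow>
        \<exists>k \<in> carrier Z. \<forall>y \<in> carrier Z. y n = x n \<longrightarrow> f y = right_translation Z k y"
      by (auto simp: topological_full_group_iff)
    have "f (u \<otimes>\<^bsub>Z\<^esub> x) = u \<otimes>\<^bsub>Z\<^esub> f x" if u: "u \<in> U n" and x: "x \<in> carrier Z" for u x
    proof -
      have uZ: "u \<in> carrier Z"
        using u by (simp add: U_def)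
      obtain k where "k \<in> carrier Z" "\<forall>y \<in> carrier Z. y n = x n \<longrightarrow> f y = right_translation Z k y"
        using n[OF x] by blast
      then show ?thesis
        using mult_U_coord(1)[OF x u] uZ x by (simp add: right_translation_def Z.m_assoc)
    qed
    then show "\<exists>n. f \<in> left_equivariant Z (U n)"
      using homeomorphisms_Bij[OF f] by (auto simp: left_equivariant_def)
  next
    assume "\<exists>n. f \<in> left_equivariant Z (U n)"
    then obtain n where f: "f \<in> left_equivariant Z (U n)"
      by blast
    have "\<exists>k \<in> carrier Z. \<forall>y \<in> carrier Z. y n = x n \<longrightarrow> f y = right_translation Z k y"
      if x: "x \<in> carrier Z" for x
    proof (intro bexI ballI impI)
      have fx: "f x \<in> carrier Z"
        using f x Bij_mem[of f] by (simp add: left_equivariant_def)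
      \<comment> \<open>The right factor at \<open>x\<close> is the inverse of \<open>x\<close>
        times \<open>f x\<close>; \<open>right_translation\<close> multiplies by an inverse, whence
        this witness.\<close>
      show "inv\<^bsub>Z\<^esub> (f x) \<otimes>\<^bsub>Z\<^esub> x \<in> carrier Z"
        using fx x by simp
      fix y assume y: "y \<in> carrier Z" "y n = x n"
      have "f ((y \<otimes>\<^bsub>Z\<^esub> inv\<^bsub>Z\<^esub> x) \<otimes>\<^bsub>Z\<^esub> x) = (y \<otimes>\<^bsub>Z\<^esub> inv\<^bsub>Z\<^esub> x) \<otimes>\<^bsub>Z\<^esub> f x"
        using f x y divide_in_U(1)[OF x y(1)] unfolding left_equivariant_def by blast
      then show "f y = right_translation Z (inv\<^bsub>Z\<^esub> (f x) \<otimes>\<^bsub>Z\<^esub> x) y"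
        using x y fx by (simp add: right_translation_def Z.inv_mult_group Z.m_assoc)
    qed
    then show "f \<in> carrier (topological_full_group T Z (right_translation Z))"
      using left_equivariant_homeomorphism[OF f] by (auto simp: topological_full_group_iff)
  qed
  then have "carrier (topological_full_group T Z (right_translation Z)) = (\<Union>n. left_equivariant Z (U n))"
    by blast
  then show ?thesis
    by (simp add: topological_full_group_def)
qed

lemma full_group_left_translation: "topological_full_group T Z (left_translation Z) = Z.right_locally"
proof -
  have "f \<in> carrier (topological_full_group T Z (left_translation Z)) \<longleftrightarrow>
    (\<exists>n. f \<in> right_equivariant Z (U n))" for f
  proof
    assume "f \<in> carrier (topological_full_group T Z (left_translation Z))"
    then obtain n where f: "f \<in> homeomorphisms T" and
      n: "\<And>x. x \<in> carrier Z \<Longrightarrow>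
        \<exists>k \<in> carrier Z. \<forall>y \<in> carrier Z. y n = x n \<longrightarrow> f y = left_translation Z k y"
      by (auto simp: topological_full_group_iff)
    have "f (x \<otimes>\<^bsub>Z\<^esub> u) = f x \<otimes>\<^bsub>Z\<^esub> u" if u: "u \<in> U n" and x: "x \<in> carrier Z" for u x
    proof -
      have uZ: "u \<in> carrier Z"
        using u by (simp add: U_def)
      obtain k where "k \<in> carrier Z" "\<forall>y \<in> carrier Z. y n = x n \<longrightarrow> f y = left_translation Z k y"
        using n[OF x] by blast
      then show ?thesis
        using mult_U_coord(2)[OF x u] uZ x by (simp add: left_translation_def Z.m_assoc)
    qed
    then show "\<exists>n. f \<in> right_equivariant Z (U n)"
      using homeomorphisms_Bij[OF f] by (auto simp: right_equivariant_def)
  next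
    assume "\<exists>n. f \<in> right_equivariant Z (U n)"
    then obtain n where f: "f \<in> right_equivariant Z (U n)"
      by blast
    have "\<exists>k \<in> carrier Z. \<forall>y \<in> carrier Z. y n = x n \<longrightarrow> f y = left_translation Z k y"
      if x: "x \<in> carrier Z" for x
    proof (intro bexI ballI impI)
      have fx: "f x \<in> carrier Z"
        using f x Bij_mem[of f] by (simp add: right_equivariant_def)
      \<comment> \<open>The left factor carrying \<open>x\<close> to \<open>f x\<close>;
        \<open>left_translation\<close> involves no inverse.\<close>
      show "f x \<otimes>\<^bsub>Z\<^esub> inv\<^bsub>Z\<^esub> x \<in> carrier Z"
        using fx x by simp
      fix y assume y: "y \<in> carrier Z" "y n = x n"
      have "f (x \<otimes>\<^bsub>Z\<^esub> (inv\<^bsub>Z\<^esub> x \<otimes>\<^bsub>Z\<^esub> y)) = f x \<otimes>\<^bsub>Z\<^esub> (inv\<^bsub>Z\<^esub> x \<otimes>\<^bsub>Z\<^esub> y)"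
        using f x y divide_in_U(2)[OF x y(1)] unfolding right_equivariant_def by blast
      then show "f y = left_translation Z (f x \<otimes>\<^bsub>Z\<^esub> inv\<^bsub>Z\<^esub> x) y"
        using x y fx by (simp add: left_translation_def Z.m_assoc Z.m_assoc[of x, symmetric])
    qed
    then show "f \<in> carrier (topological_full_group T Z (left_translation Z))"
      using right_equivariant_homeomorphism[OF f] by (auto simp: topological_full_group_iff)
  qed
  then have "carrier (topological_full_group T Z (left_translation Z)) = (\<Union>n. right_equivariant Z (U n))"
    by blast
  then show ?thesis
    by (simp add: topological_full_group_def)
qed

text \<open>The sets \<open>K \<Gamma>\<^sub>n\<close> are unions of the finitely many cosets of \<open>K\<close>, so they are eventually
  constant.\<close>

lemma U_subset_closure:
  assumes K: "finite_index G K"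
  obtains n where "\<And>u m. u \<in> U n \<Longrightarrow> \<exists>k \<in> K. \<tau> k m = u m"
proof -
  have sub: "subgroup K G" and fin: "finite (rcosets K)"
    using K by (auto simp: finite_index_def)
  \<comment> \<open>The cosets making up \<open>K \<Gamma>\<^sub>n\<close>: a decreasing sequence of
    finite sets. Minimal cardinality therefore marks a level from which on it is constant.\<close>
  define R where "R = (\<lambda>n. {C \<in> rcosets K. C \<inter> \<Gamma> n \<noteq> {}})"
  have R_anti: "R n \<subseteq> R m" if "m \<le> n" for m n
    using \<Gamma>_anti[OF that] by (auto simp: R_def)
  have R_fin: "finite (R n)" for n
    using fin by (auto simp: R_def)
  define n where "n = (ARG_MIN (\<lambda>n. card (R n)) n. True)"
  have card_min: "card (R n) \<le> card (R m)" for m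
    unfolding n_def by (rule arg_min_nat_le) simp
  have R_const: "R n \<subseteq> R m" for m
  proof (cases "m \<le> n")
    case False
    then have "R m = R n"
      using card_min[of m] R_anti[of n m] R_fin[of n] by (intro card_seteq) auto
    then show ?thesis
      by simp
  qed (rule R_anti)
  show thesis
  proof (rule that[of n])
    fix u m assume u: "u \<in> U n"
    then have uZ: "u \<in> carrier Z"
      by (simp add: U_def)
    \<comment> \<open>One \<open>g\<close> must represent \<open>u\<close> both at level
      \<open>n\<close>, where \<open>u\<close> is trivial, and at the level \<open>m\<close> to be
      approximated.\<close>
    let ?m = "max n m"
    obtain g where g: "g \<in> carrier G" "u ?m = \<tau> g ?m"
      using coord_eq_\<tau>[OF Z_coord[OF uZ, of ?m]] by blast
    have u_eq: "u i = \<tau> g i" if "i \<le> ?m" for i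
      using coord_determined[OF uZ \<tau>_in_Z[OF g(1)] g(2) that] .
    have "\<Gamma> n #> g = \<Gamma> n"
      using u_eq[of n] u by (simp add: U_def odometer_embedding_def)
    then have "g \<in> \<Gamma> n"
      using coset_join1[OF _ g(1) \<Gamma>_subgroup] by simp
    then have "K #> g \<in> R n"
      using rcosetsI[OF subgroup.subset[OF sub] g(1)] rcos_self[OF g(1) sub] by (auto simp: R_def)
    then have "(K #> g) \<inter> \<Gamma> ?m \<noteq> {}"
      using R_const[of ?m] by (auto simp: R_def)
    then obtain k where k: "k \<in> K" "k \<otimes> g \<in> \<Gamma> ?m"
      by (auto simp: r_coset_def)
    have kG: "k \<in> carrier G"
      using subgroup.mem_carrier[OF sub k(1)] .
    have "inv k \<in> K"
      using subgroup.m_inv_closed[OF sub k(1)] .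
    moreover have "\<tau> (inv k) ?m = u ?m"
    proof -
      \<comment> \<open>Conjugating \<open>k \<otimes> g\<close> by \<open>k\<close> gives the order
        of factors in which comparing the cosets of \<open>g\<close> and \<open>inv k\<close> tests
        membership.\<close>
      have "g \<otimes> k \<in> \<Gamma> ?m"
        using normal.inv_op_closed1[OF \<Gamma>_normal kG k(2)] kG g(1) by (simp add: m_assoc[symmetric])
      then have "\<Gamma> ?m #> g = \<Gamma> ?m #> inv k"
        using rcos_eq_iff[OF \<Gamma>_subgroup g(1), of "inv k"] kG by simp
      then show ?thesis
        using g(2) by (simp add: odometer_embedding_def)
    qed
    then have "\<tau> (inv k) m = u m"
      using coord_determined[OF \<tau>_in_Z uZ] kG by simp
    ultimately show "\<exists>k \<in> K. \<tau> k m = u m"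
      by blast
  qed
qed

text \<open>Commutation passes from \<open>K\<close> to \<open>U n\<close> one coordinate at a time:
  for given \<open>u\<close>, \<open>x\<close> and output level, continuity sees only finitely much
  of \<open>u\<close>, and some element of \<open>K\<close> agrees with \<open>u\<close> that far.
  Conversely \<open>\<tau>\<close> maps \<open>\<Gamma> n\<close> into \<open>U n\<close>, so
  \<open>\<Gamma> n\<close> itself serves as the finite-index subgroup.\<close>

lemma stabilized_automorphism_group_eq:
  "stabilized_automorphism_group T G (odometer_action G \<Gamma>) = Z.left_locally"
proof -
  have "(\<Union>K \<in> {K. finite_index G K}. automorphisms T (odometer_action G \<Gamma>) K)
      = (\<Union>n. left_equivariant Z (U n))"
  proof (intro equalityI subsetI)
    fix f assume "f \<in> (\<Union>K \<in> {K. finite_index G K}. automorphisms T (odometer_action G \<Gamma>) K)"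
    then obtain K where K: "finite_index G K" and f: "f \<in> homeomorphisms T"
      and comm: "\<And>k x. k \<in> K \<Longrightarrow> x \<in> carrier Z \<Longrightarrow>
        f (odometer_action G \<Gamma> k x) = odometer_action G \<Gamma> k (f x)"
      by (auto simp: automorphisms_def)
    have KG: "k \<in> carrier G" if "k \<in> K" for k
      using K that by (auto simp: finite_index_def dest: subgroup.mem_carrier)
    have fZ: "f x \<in> carrier Z" if "x \<in> carrier Z" for x
      using Bij_mem[OF homeomorphisms_Bij[OF f] that] .
    have "continuous_map T T f"
      using f by (auto simp: homeomorphisms_def homeomorphic_imp_continuous_map)
    then have cont: "\<forall>x \<in> carrier Z. \<forall>m. \<exists>n. \<forall>y \<in> carrier Z. y n = x n \<longrightarrow> f y m = f x m"
      by (subst (asm) continuous_map_T_iff[OF fZ])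
    obtain n where n: "\<And>u m. u \<in> U n \<Longrightarrow> \<exists>k \<in> K. \<tau> k m = u m"
      using U_subset_closure[OF K] by blast
    have "f (u \<otimes>\<^bsub>Z\<^esub> x) = u \<otimes>\<^bsub>Z\<^esub> f x" if u: "u \<in> U n" and x: "x \<in> carrier Z" for u x
    proof
      fix m
      have uZ: "u \<in> carrier Z" and ux: "u \<otimes>\<^bsub>Z\<^esub> x \<in> carrier Z"
        using u x by (auto simp: U_def)
      \<comment> \<open>A modulus of continuity of \<open>f\<close> at this one point, for the
        coordinate \<open>m\<close>.\<close>
      obtain l where l: "\<And>y. y \<in> carrier Z \<Longrightarrow> y l = (u \<otimes>\<^bsub>Z\<^esub> x) l \<Longrightarrow> f y m = f (u \<otimes>\<^bsub>Z\<^esub> x) m"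
        using bspec[OF cont ux, THEN spec, of m] by (elim exE) (rule that, blast)
      \<comment> \<open>Level \<open>l\<close> lets \<open>u\<close> be replaced by
        \<open>\<tau> k\<close> inside \<open>f\<close>; level \<open>m\<close> lets it be restored
        in front of \<open>f x\<close>.\<close>
      obtain k where k: "k \<in> K" "\<tau> k (max l m) = u (max l m)"
        using n[OF u] by blast
      have k_eq: "\<tau> k i = u i" if "i \<le> max l m" for i
        using coord_determined[OF \<tau>_in_Z[OF KG[OF k(1)]] uZ k(2) that] .
      have kx: "\<tau> k \<otimes>\<^bsub>Z\<^esub> x \<in> carrier Z"
        using \<tau>_in_Z[OF KG[OF k(1)]] x by simp
      have "f (u \<otimes>\<^bsub>Z\<^esub> x) m = f (\<tau> k \<otimes>\<^bsub>Z\<^esub> x) m"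
        using l[OF kx] k_eq[of l] by (simp add: mult_coord)
      also have "f (\<tau> k \<otimes>\<^bsub>Z\<^esub> x) = \<tau> k \<otimes>\<^bsub>Z\<^esub> f x"
        using comm[OF k(1) x] x fZ[OF x] by (simp add: odometer_action_def)
      also have "(\<tau> k \<otimes>\<^bsub>Z\<^esub> f x) m = (u \<otimes>\<^bsub>Z\<^esub> f x) m"
        using k_eq[of m] by (simp add: mult_coord)
      finally show "f (u \<otimes>\<^bsub>Z\<^esub> x) m = (u \<otimes>\<^bsub>Z\<^esub> f x) m" .
    qed
    then show "f \<in> (\<Union>n. left_equivariant Z (U n))"
      using homeomorphisms_Bij[OF f] by (auto simp: left_equivariant_def)
  next
    fix f assume "f \<in> (\<Union>n. left_equivariant Z (U n))"
    then obtain n where f: "f \<in> left_equivariant Z (U n)"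
      by blast
    have "f (odometer_action G \<Gamma> g x) = odometer_action G \<Gamma> g (f x)"
      if g: "g \<in> \<Gamma> n" and x: "x \<in> carrier Z" for g x
    proof -
      have gG: "g \<in> carrier G"
        using subgroup.mem_carrier[OF \<Gamma>_subgroup g] .
      have "\<tau> g \<in> U n"
        using \<tau>_in_Z[OF gG] coset_join2[OF gG \<Gamma>_subgroup g]
        by (simp add: U_def odometer_embedding_def)
      then show ?thesis
        using f x Bij_mem[of f] by (simp add: left_equivariant_def odometer_action_def)
    qed
    then have "f \<in> automorphisms T (odometer_action G \<Gamma>) (\<Gamma> n)"
      using left_equivariant_homeomorphism[OF f] by (simp add: automorphisms_def)
    then show "f \<in> (\<Union>K \<in> {K. finite_index G K}. automorphisms T (odometer_action G \<Gamma>) K)"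
      using \<Gamma>_index by blast
  qed
  then show ?thesis
    by (simp add: stabilized_automorphism_group_def)
qed

end

theorem corollary4p9:
  fixes G :: "('a, 'b) monoid_scheme" and \<Gamma> :: "nat \<Rightarrow> 'a set"
  assumes "group G" and "countable (carrier G)" and "infinite (carrier G)"
    and "residually_finite G" and "subgroup_scale G \<Gamma>"
  defines "Z \<equiv> odometer G \<Gamma>" and "T \<equiv> odometer_topology G \<Gamma>"
  shows "(amenable (stabilized_automorphism_group T G (odometer_action G \<Gamma>)) \<longleftrightarrow> amenable Z) \<and>
    (amenable Z \<longleftrightarrow> amenable (topological_full_group T Z (left_translation Z))) \<and>
    (amenable Z \<longleftrightarrow> amenable (topological_full_group T Z (right_translation Z)))"
proof -
  interpret free_odometer G \<Gamma>
    using assms(1,5) by (simp add: free_odometer_def free_odometer_axioms_def)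
  show ?thesis
    \<comment> \<open>After these rewritings all three groups are represented by
      \<open>Z.left_locally\<close>, the one from left translations by way of inversion.\<close>
    unfolding Z_def T_def stabilized_automorphism_group_eq full_group_left_translation
      full_group_right_translation Z.amenable_right_locally_iff
    using Z.amenable_left_locally Z.amenable_of_left_locally by blast
qed

end
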